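(* Consider the anisotropic XY chain with couplings $\mu_j\in\mathbb{R}\setminus\{0\}$, $\gamma_j\in\mathbb{R}\setminus\{\pm1\}$, $\nu_j\in\mathbb{R}$ ($j\in\mathbb{Z}$) forming periodic sequences, not necessarily of the same period. Let $M^{(\infty)}$ be the associated periodic block Jacobi matrix on $\ell^2(\mathbb{Z})^2$ and let $Q$ be its asymptotic velocity operator. If for some $n_0\in\mathbb{N}$ there are constants $C,\eta>0$ and a velocity $v\ge0$ such that for every $\Lambda=[m,n]\cap\mathbb{Z}$ with $|\Lambda|\ge n_0$, every $(A,B)\in\mathcal{D}^{(\Lambda)}$ with $\operatorname{supp}A=S_1$, $\operatorname{supp}B=S_2$, and every $t\in\mathbb{R}$, $$\|[\tau^{(\Lambda)}_t(A),B]\|\le C\|A\|\,\|B\|\,e^{-\eta(d(S_1,S_2)-v|t|)},$$ then $v\ge\|Q\|$.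
   Context: For finite $S\subset\mathbb{Z}$, $\mathcal{A}_S=\bigotimes_{j\in S}M(2,\mathbb{C})$ acts on $\bigotimes_{j\in S}\mathbb{C}^2$; for $S_1\subset S_2$ one views $\mathcal{A}_{S_1}\subset\mathcal{A}_{S_2}$ via $A\mapsto A\otimes\mathbb{I}_{S_2\setminus S_1}$. $\operatorname{supp}A$ is the smallest $S$ with $A\in\mathcal{A}_S$. For $\Lambda=[m,n]\cap\mathbb{Z}$, the XY Hamiltonian is $$H^{(\Lambda)}=\sum_{j=m}^{n-1}\mu_j\big[(1+\gamma_j)\sigma^{(x)}_j\sigma^{(x)}_{j+1}+(1-\gamma_j)\sigma^{(y)}_j\sigma^{(y)}_{j+1}\big]+\sum_{j=m}^n\nu_j\sigma^{(z)}_j,$$ with $\sigma^{(x)},\sigma^{(y)},\sigma^{(z)}$ the Pauli matrices, the subscript $j$ meaning acting on the $j$-th tensor factor. $\tau^{(\Lambda)}_t(A)=e^{itH^{(\Lambda)}}Ae^{-itH^{(\Lambda)}}$, $d(S_1,S_2)=\min_{(i,j)\in S_1\times S_2}|i-j|$. $\mathcal{D}^{(\Lambda)}$ is the set of pairs $(A,B)\in\mathcal{A}_\Lambda\times\mathcal{A}_\Lambda$ with $\max\operatorname{supp}A<\min\operatorname{supp}B$. $M^{(\infty)}$ is the bounded self-adjoint operator on $\ell^2(\mathbb{Z})^2$ (sequences $u=(u_j)_{j\in\mathbb{Z}}$, $u_j\in\mathbb{C}^2$) given by $(M^{(\infty)}u)_j=\Gamma_j^*u_{j-1}+J_ju_j+\Gamma_{j+1}u_{j+1}$,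 where $J_j=2\begin{pmatrix}\nu_j&0\\0&-\nu_j\end{pmatrix}$ and $\Gamma_j=2\begin{pmatrix}-\mu_{j-1}&-\mu_{j-1}\gamma_{j-1}\\ \mu_{j-1}\gamma_{j-1}&\mu_{j-1}\end{pmatrix}$. With $(Xu)_j=ju_j$ on $D(X)=\{u:\sum_j|ju_j|^2<\infty\}$, the operator $Q$ is the bounded self-adjoint operator on $\ell^2(\mathbb{Z})^2$ determined by $Q\psi=\lim_{t\to\infty}\frac1te^{itM^{(\infty)}}Xe^{-itM^{(\infty)}}\psi$ for $\psi\in D(X)$ (this limit exists because $M^{(\infty)}$ is a periodic block Jacobi matrix with invertible off-diagonal blocks). *)

theory Defs
  imports "HOL-Analysis.Analysis"
begin

section \<open>The Hilbert space \<open>\<ell>\<^sup>2(\<int>)\<^sup>2\<close>\<close>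

typedef l2 = "{u :: int \<Rightarrow> complex ^ 2. (\<lambda>j. (norm (u j))\<^sup>2) summable_on UNIV}"
  morphisms seq_of Abs_l2
  by (rule exI[of _ "\<lambda>_. 0"]) simp

setup_lifting type_definition_l2

lemma l2_add_aux:
  fixes u w :: "int \<Rightarrow> complex ^ 2"
  assumes "(\<lambda>j. (norm (u j))\<^sup>2) summable_on UNIV" "(\<lambda>j. (norm (w j))\<^sup>2) summable_on UNIV"
  shows "(\<lambda>j. (norm (u j + w j))\<^sup>2) summable_on UNIV"
proof (rule summable_on_comparison_test)
  show "(\<lambda>j. 2 * (norm (u j))\<^sup>2 + 2 * (norm (w j))\<^sup>2) summable_on UNIV"
    using assms by (intro summable_on_add summable_on_cmult_right)
next
  fix j
  have "(norm (u j + w j))\<^sup>2 \<le> (norm (u j) + norm (w j))\<^sup>2"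
    by (intro power_mono norm_triangle_ineq) auto
  also have "\<dots> \<le> 2 * (norm (u j))\<^sup>2 + 2 * (norm (w j))\<^sup>2"
    using sum_squares_bound[of "norm (u j)" "norm (w j)"] by (simp add: power2_sum)
  finally show "(norm (u j + w j))\<^sup>2 \<le> 2 * (norm (u j))\<^sup>2 + 2 * (norm (w j))\<^sup>2" .
qed auto

lemma norm_vector_scalar_mult: "norm (c *s v) = norm c * norm (v :: complex ^ 'n)"
  by (simp add: norm_vec_def L2_set_def norm_mult power_mult_distrib
      flip: sum_distrib_left) (simp add: real_sqrt_mult)

instantiation l2 :: real_vector
begin

lift_definition zero_l2 :: l2 is "\<lambda>_. 0" by simp

lift_definition plus_l2 :: "l2 \<Rightarrow> l2 \<Rightarrow> l2" is "\<lambda>u w j. u j + w j"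
  by (rule l2_add_aux)

lift_definition uminus_l2 :: "l2 \<Rightarrow> l2" is "\<lambda>u j. - u j" by simp

lift_definition minus_l2 :: "l2 \<Rightarrow> l2 \<Rightarrow> l2" is "\<lambda>u w j. u j - w j"
  subgoal for u w using l2_add_aux[of u "\<lambda>j. - w j"] by simp
  done

lift_definition scaleR_l2 :: "real \<Rightarrow> l2 \<Rightarrow> l2" is "\<lambda>r u j. r *\<^sub>R u j"
  by (simp add: power_mult_distrib summable_on_cmult_right)

instance
  by standard (transfer; simp add: fun_eq_iff algebra_simps)+

end

lift_definition scaleC :: "complex \<Rightarrow> l2 \<Rightarrow> l2" (infixr \<open>*\<^sub>C\<close> 75) is "\<lambda>c u j. c *s u j"
  by (simp add: norm_vector_scalar_mult power_mult_distrib summable_on_cmult_right)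

definition cinner :: "l2 \<Rightarrow> l2 \<Rightarrow> complex"
  where "cinner u w = (\<Sum>\<^sub>\<infinity>j. \<Sum>i\<in>UNIV. cnj (seq_of u j $ i) * (seq_of w j $ i))"

instantiation l2 :: real_inner
begin

text \<open>Real part of \<^const>\<open>cinner\<close>; the induced norm is the usual norm of \<open>\<ell>\<^sup>2(\<int>)\<^sup>2\<close>
  (lemmas \<open>Re_cinner\<close> and \<open>norm_l2_eq\<close> below).\<close>

definition inner_l2 :: "l2 \<Rightarrow> l2 \<Rightarrow> real"
  where "inner_l2 u w = (\<Sum>\<^sub>\<infinity>j. seq_of u j \<bullet> seq_of w j)"

definition norm_l2 :: "l2 \<Rightarrow> real"
  where "norm_l2 u = sqrt (u \<bullet> u)"

definition sgn_l2 :: "l2 \<Rightarrow> l2"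
  where "sgn_l2 u = u /\<^sub>R norm u"

definition dist_l2 :: "l2 \<Rightarrow> l2 \<Rightarrow> real"
  where "dist_l2 u w = norm (u - w)"

definition uniformity_l2 :: "(l2 \<times> l2) filter"
  where "uniformity_l2 = (INF e\<in>{0<..}. principal {(x, y). dist x y < e})"

definition open_l2 :: "l2 set \<Rightarrow> bool"
  where "open_l2 U \<longleftrightarrow> (\<forall>x\<in>U. \<forall>\<^sub>F (x', y) in uniformity. x' = x \<longrightarrow> y \<in> U)"

lemma l2_summable_sq: "(\<lambda>j. (norm (seq_of u j))\<^sup>2) summable_on UNIV"
  using seq_of[of u] by simp

lemma l2_summable_mult:
  "(\<lambda>j. norm (seq_of u j) * norm (seq_of w j)) summable_on UNIV"
proof (rule summable_on_comparison_test)
  show "(\<lambda>j. (norm (seq_of u j))\<^sup>2 + (norm (seq_of w j))\<^sup>2) summable_on UNIV"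
    by (intro summable_on_add l2_summable_sq)
next
  fix j
  have "0 \<le> norm (seq_of u j) * norm (seq_of w j)" by simp
  then show "norm (seq_of u j) * norm (seq_of w j) \<le> (norm (seq_of u j))\<^sup>2 + (norm (seq_of w j))\<^sup>2"
    using sum_squares_bound[of "norm (seq_of u j)" "norm (seq_of w j)"] by linarith
qed simp

lemma l2_summable_inner: "(\<lambda>j. seq_of u j \<bullet> seq_of w j) summable_on UNIV"
proof (rule abs_summable_summable)
  show "(\<lambda>j. norm (seq_of u j \<bullet> seq_of w j)) summable_on UNIV"
    by (rule summable_on_comparison_test[OF l2_summable_mult[of u w]])
      (auto simp: Cauchy_Schwarz_ineq2)
qed

instance
proof
  fix x y z :: l2 and r :: real
  show "dist x y = norm (x - y)" by (rule dist_l2_def)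
  show "sgn x = x /\<^sub>R norm x" by (rule sgn_l2_def)
  show "uniformity = (INF e\<in>{0<..}. principal {(x::l2, y). dist x y < e})"
    by (rule uniformity_l2_def)
  show "open U \<longleftrightarrow> (\<forall>x\<in>U. \<forall>\<^sub>F (x', y) in uniformity. x' = x \<longrightarrow> y \<in> U)" for U :: "l2 set"
    by (rule open_l2_def)
  show "x \<bullet> y = y \<bullet> x" by (simp add: inner_l2_def inner_commute)
  show "(x + y) \<bullet> z = x \<bullet> z + y \<bullet> z"
    by (simp add: inner_l2_def plus_l2.rep_eq inner_add_left infsum_add l2_summable_inner)
  show "(r *\<^sub>R x) \<bullet> y = r * (x \<bullet> y)"
    by (simp add: inner_l2_def scaleR_l2.rep_eq infsum_cmult_right l2_summable_inner)
  show nn: "0 \<le> x \<bullet> x"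
    by (simp add: inner_l2_def infsum_nonneg)
  show "x \<bullet> x = 0 \<longleftrightarrow> x = 0"
  proof
    assume "x \<bullet> x = 0"
    then have "seq_of x j \<bullet> seq_of x j = 0" for j
      using nonneg_infsum_le_0D[OF _ l2_summable_inner[of x x], of j]
      by (simp add: inner_l2_def)
    then show "x = 0" by (simp add: seq_of_inject[symmetric] zero_l2.rep_eq fun_eq_iff)
  qed (simp add: inner_l2_def zero_l2.rep_eq)
  show "norm x = sqrt (x \<bullet> x)" by (rule norm_l2_def)
qed

end

lemma norm_l2_eq: "norm (u :: l2) = sqrt (\<Sum>\<^sub>\<infinity>j. (norm (seq_of u j))\<^sup>2)"
  by (simp add: norm_l2_def inner_l2_def power2_norm_eq_inner)

lemma Re_cinner: "Re (cinner u w) = u \<bullet> w"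
proof -
  have le: "cmod (v $ i) \<le> norm v" for v :: "complex ^ 2" and i
    by (rule Finite_Cartesian_Product.norm_nth_le)
  have "(\<lambda>j. cnj (seq_of u j $ i) * (seq_of w j $ i)) summable_on UNIV" for i
  proof (rule abs_summable_summable)
    show "(\<lambda>j. norm (cnj (seq_of u j $ i) * (seq_of w j $ i))) summable_on UNIV"
      by (rule summable_on_comparison_test[OF l2_summable_mult[of u w]])
        (auto simp: norm_mult intro!: mult_mono le)
  qed
  then have "(\<lambda>j. \<Sum>i\<in>UNIV. cnj (seq_of u j $ i) * (seq_of w j $ i)) summable_on UNIV"
    by (simp add: sum_2 summable_on_add)
  then have "Re (cinner u w) = (\<Sum>\<^sub>\<infinity>j. Re (\<Sum>i\<in>UNIV. cnj (seq_of u j $ i) * (seq_of w j $ i)))"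
    unfolding cinner_def by (rule infsum_Re[symmetric])
  then show ?thesis
    by (simp add: inner_l2_def inner_vec_def inner_complex_def)
qed

lemma l2_sum_le_norm:
  assumes "finite F"
  shows "(\<Sum>j\<in>F. (norm (seq_of u j))\<^sup>2) \<le> (norm u)\<^sup>2"
proof -
  have "(\<Sum>j\<in>F. (norm (seq_of u j))\<^sup>2) \<le> (\<Sum>\<^sub>\<infinity>j. (norm (seq_of u j))\<^sup>2)"
    using finite_sum_le_infsum[OF l2_summable_sq assms] by simp
  then show ?thesis by (simp add: norm_l2_eq infsum_nonneg)
qed

lemma norm_seq_of_le: "norm (seq_of u j) \<le> norm u"
  using l2_sum_le_norm[of "{j}" u] by (simp add: power2_le_iff_abs_le)

instance l2 :: complete_space
proof
  fix X :: "nat \<Rightarrow> l2"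
  assume X: "Cauchy X"
  have "Cauchy (\<lambda>n. seq_of (X n) j)" for j
  proof (rule metric_CauchyI)
    fix e :: real assume "0 < e"
    then obtain N where "\<And>m n. m \<ge> N \<Longrightarrow> n \<ge> N \<Longrightarrow> dist (X m) (X n) < e"
      using metric_CauchyD[OF X] by blast
    moreover have "dist (seq_of (X m) j) (seq_of (X n) j) \<le> dist (X m) (X n)" for m n
      using norm_seq_of_le[of "X m - X n" j] by (simp add: dist_norm minus_l2.rep_eq)
    ultimately show "\<exists>N. \<forall>m\<ge>N. \<forall>n\<ge>N. dist (seq_of (X m) j) (seq_of (X n) j) < e"
      by (meson le_less_trans)
  qed
  then have "\<exists>l. (\<lambda>n. seq_of (X n) j) \<longlonglongrightarrow> l" for j
    by (simp add: Cauchy_convergent convergent_def[symmetric])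
  then obtain u where u: "\<And>j. (\<lambda>n. seq_of (X n) j) \<longlonglongrightarrow> u j" by metis
  have fin: "(\<Sum>j\<in>F. (norm (seq_of (X m) j - u j))\<^sup>2) \<le> e\<^sup>2"
    if "finite F" and N: "\<And>n. n \<ge> N \<Longrightarrow> dist (X m) (X n) < e" for F N m e
  proof (rule tendsto_le[OF trivial_limit_sequentially tendsto_const])
    show "(\<lambda>n. \<Sum>j\<in>F. (norm (seq_of (X m) j - seq_of (X n) j))\<^sup>2)
        \<longlonglongrightarrow> (\<Sum>j\<in>F. (norm (seq_of (X m) j - u j))\<^sup>2)"
      by (intro tendsto_intros u)
    show "\<forall>\<^sub>F n in sequentially. (\<Sum>j\<in>F. (norm (seq_of (X m) j - seq_of (X n) j))\<^sup>2) \<le> e\<^sup>2"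
      using eventually_ge_at_top[of N]
    proof eventually_elim
      case (elim n)
      have "(\<Sum>j\<in>F. (norm (seq_of (X m - X n) j))\<^sup>2) \<le> (norm (X m - X n))\<^sup>2"
        by (rule l2_sum_le_norm[OF \<open>finite F\<close>])
      also have "\<dots> \<le> e\<^sup>2"
        using N[OF elim] by (intro power_mono) (auto simp: dist_norm)
      finally show ?case by (simp add: minus_l2.rep_eq)
    qed
  qed
  have sq: "(\<lambda>j. (norm (seq_of (X m) j - u j))\<^sup>2) summable_on UNIV"
    if "\<And>n. n \<ge> N \<Longrightarrow> dist (X m) (X n) < e" for N m e
    by (rule nonneg_bdd_above_summable_on) (auto intro!: bdd_aboveI2[of _ _ "e\<^sup>2"] fin[OF _ that])
  obtain N0 where N0: "\<And>m n. m \<ge> N0 \<Longrightarrow> n \<ge> N0 \<Longrightarrow> dist (X m) (X n) < 1"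
    using metric_CauchyD[OF X zero_less_one] by blast
  have "(\<lambda>j. (norm (seq_of (X N0) j + - (seq_of (X N0) j - u j)))\<^sup>2) summable_on UNIV"
    using sq[of N0 N0 1] N0 by (intro l2_add_aux l2_summable_sq) (auto simp: norm_minus_commute)
  then have U: "seq_of (Abs_l2 u) = u"
    by (intro Abs_l2_inverse) simp
  have "X \<longlonglongrightarrow> Abs_l2 u"
  proof (rule metric_LIMSEQ_I)
    fix e :: real assume "0 < e"
    then obtain N where N: "\<And>m n. m \<ge> N \<Longrightarrow> n \<ge> N \<Longrightarrow> dist (X m) (X n) < e / 2"
      using metric_CauchyD[OF X, of "e / 2"] by auto
    have "dist (X m) (Abs_l2 u) < e" if "m \<ge> N" for m
    proof -
      have "(\<Sum>\<^sub>\<infinity>j. (norm (seq_of (X m) j - u j))\<^sup>2) \<le> (e / 2)\<^sup>2"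
        using N[OF that]
        by (intro infsum_le_finite_sums sq[of N m "e / 2"] fin[of _ N m "e / 2"]) auto
      then have "norm (X m - Abs_l2 u) \<le> sqrt ((e / 2)\<^sup>2)"
        unfolding norm_l2_eq minus_l2.rep_eq U by (rule real_sqrt_le_mono)
      then show ?thesis using \<open>0 < e\<close> by (simp add: dist_norm)
    qed
    then show "\<exists>N. \<forall>n\<ge>N. dist (X n) (Abs_l2 u) < e" by blast
  qed
  then show "convergent X" by (auto simp: convergent_def)
qed

section \<open>The block Jacobi matrix and its asymptotic velocity\<close>

definition periodic :: "(int \<Rightarrow> 'a) \<Rightarrow> bool"
  where "periodic f \<longleftrightarrow> (\<exists>p>0. \<forall>j. f (j + p) = f j)"

definition J_block :: "(int \<Rightarrow> real) \<Rightarrow> int \<Rightarrow> complex ^ 2 ^ 2" where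
  "J_block \<nu> j =
    vector [vector [2 * of_real (\<nu> j), 0],
            vector [0, - 2 * of_real (\<nu> j)]]"

definition \<Gamma>_block :: "(int \<Rightarrow> real) \<Rightarrow> (int \<Rightarrow> real) \<Rightarrow> int \<Rightarrow> complex ^ 2 ^ 2" where
  "\<Gamma>_block \<mu> \<gamma> j =
    vector [vector [- 2 * of_real (\<mu> (j - 1)), - 2 * of_real (\<mu> (j - 1) * \<gamma> (j - 1))],
            vector [2 * of_real (\<mu> (j - 1) * \<gamma> (j - 1)), 2 * of_real (\<mu> (j - 1))]]"

definition conj_transpose :: "complex ^ 'n ^ 'm \<Rightarrow> complex ^ 'm ^ 'n"
  where "conj_transpose A = (\<chi> i j. cnj (A $ j $ i))"

definition M_inf :: "(int \<Rightarrow> real) \<Rightarrow> (int \<Rightarrow> real) \<Rightarrow> (int \<Rightarrow> real) \<Rightarrow> l2 \<Rightarrow> l2" where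
  "M_inf \<mu> \<gamma> \<nu> u = Abs_l2 (\<lambda>j.
      conj_transpose (\<Gamma>_block \<mu> \<gamma> j) *v seq_of u (j - 1)
    + J_block \<nu> j *v seq_of u j
    + \<Gamma>_block \<mu> \<gamma> (j + 1) *v seq_of u (j + 1))"

lemma periodic_finite_range:
  assumes "periodic f" shows "finite (range f)"
proof -
  obtain p :: int where p: "p > 0" "\<And>j. f (j + p) = f j"
    using assms by (auto simp: periodic_def)
  have up: "f (j + int k * p) = f j" for j k
  proof (induction k)
    case (Suc k)
    have "f (j + int (Suc k) * p) = f ((j + int k * p) + p)" by (simp add: algebra_simps)
    then show ?case using p(2) Suc by simp
  qed simp
  have "f j = f (j mod p)" for j
  proof (cases "j div p \<ge> 0")
    case True
    then show ?thesis using up[of "j mod p" "nat (j div p)"] by simp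
  next
    case False
    then have "j + int (nat (- (j div p))) * p = j mod p"
      by (simp add: minus_div_mult_eq_mod[symmetric] algebra_simps)
    then show ?thesis using up[of j "nat (- (j div p))"] by simp
  qed
  then have "range f \<subseteq> f ` {0..<p}"
    using p(1) by (force intro: image_eqI[where x = "_ mod p"])
  then show ?thesis by (rule finite_subset) simp
qed

lemma norm_mat_vec_le:
  fixes A :: "complex ^ 2 ^ 2"
  shows "norm (A *v x) \<le> (\<Sum>i\<in>UNIV. \<Sum>k\<in>UNIV. cmod (A $ i $ k)) * norm x"
proof -
  have "norm (A *v x) \<le> (\<Sum>i\<in>UNIV. cmod ((A *v x) $ i))"
    unfolding norm_vec_def by (rule L2_set_le_sum) simp
  also have "\<dots> \<le> (\<Sum>i\<in>UNIV. \<Sum>k\<in>UNIV. cmod (A $ i $ k) * norm x)"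
    unfolding matrix_vector_mult_def
    by (auto intro!: sum_mono sum_norm_le mult_left_mono Finite_Cartesian_Product.norm_nth_le
        simp: norm_mult)
  finally show ?thesis by (simp add: sum_distrib_right)
qed

lemma l2_finite_range_mult:
  fixes B :: "int \<Rightarrow> complex ^ 2 ^ 2"
  assumes "finite (range B)" and u: "(\<lambda>j. (norm (u j))\<^sup>2) summable_on UNIV"
  shows "(\<lambda>j. (norm (B j *v u j))\<^sup>2) summable_on UNIV"
proof (rule summable_on_comparison_test)
  define S where "S A = (\<Sum>i\<in>UNIV. \<Sum>k\<in>UNIV. cmod (A $ i $ k))" for A :: "complex ^ 2 ^ 2"
  define K where "K = Max (range (\<lambda>j. S (B j)))"
  have "finite (range (\<lambda>j. S (B j)))"
    using finite_imageI[OF assms(1), of S] by (simp add: image_image)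
  then have "S (B j) \<le> K" for j by (simp add: K_def)
  then have "norm (B j *v u j) \<le> K * norm (u j)" for j
    using norm_mat_vec_le[of "B j" "u j"] mult_right_mono[of "S (B j)" K "norm (u j)"]
    by (fastforce simp: S_def)
  then show "(norm (B j *v u j))\<^sup>2 \<le> K\<^sup>2 * (norm (u j))\<^sup>2" for j
    by (metis norm_ge_zero power_mono power_mult_distrib)
  show "(\<lambda>j. K\<^sup>2 * (norm (u j))\<^sup>2) summable_on UNIV"
    by (intro summable_on_cmult_right u)
qed simp

text \<open>\<^const>\<open>Abs_l2\<close> is applied within its domain.\<close>

lemma seq_of_M_inf:
  assumes "periodic \<mu>" "periodic \<gamma>" "periodic \<nu>"
  shows "seq_of (M_inf \<mu> \<gamma> \<nu> u) j =
      conj_transpose (\<Gamma>_block \<mu> \<gamma> j) *v seq_of u (j - 1)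
    + J_block \<nu> j *v seq_of u j
    + \<Gamma>_block \<mu> \<gamma> (j + 1) *v seq_of u (j + 1)"
proof -
  define G :: "real \<times> real \<Rightarrow> complex ^ 2 ^ 2" where "G = (\<lambda>(a, b).
    vector [vector [- 2 * of_real a, - 2 * of_real (a * b)],
            vector [2 * of_real (a * b), 2 * of_real a]])"
  have G: "\<Gamma>_block \<mu> \<gamma> j = G (\<mu> (j - 1), \<gamma> (j - 1))" for j
    by (simp add: \<Gamma>_block_def G_def)
  have fin: "finite (range \<mu> \<times> range \<gamma>)"
    using assms by (intro finite_cartesian_product periodic_finite_range)
  have 1: "finite (range (\<lambda>j. conj_transpose (\<Gamma>_block \<mu> \<gamma> j)))"
    by (rule finite_subset[OF _ finite_imageI[OF fin, of "\<lambda>x. conj_transpose (G x)"]]) (auto simp: G)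
  have 2: "finite (range (\<lambda>j. \<Gamma>_block \<mu> \<gamma> (j + 1)))"
    by (rule finite_subset[OF _ finite_imageI[OF fin, of G]]) (auto simp: G)
  have 3: "finite (range (J_block \<nu>))"
    by (rule finite_subset[OF _ finite_imageI[OF periodic_finite_range[OF assms(3)],
          of "\<lambda>a. vector [vector [2 * of_real a, 0], vector [0, - 2 * of_real a]]"]])
      (auto simp: J_block_def)
  have shift: "(\<lambda>j. (norm (seq_of u (j + k)))\<^sup>2) summable_on UNIV" for k :: int
    using summable_on_reindex_bij_betw[of "\<lambda>j. j + k" UNIV UNIV "\<lambda>j. (norm (seq_of u j))\<^sup>2"]
      l2_summable_sq[of u] by (simp add: bij_plus_right)
  show ?thesis unfolding M_inf_def
    using l2_finite_range_mult[OF 1 shift[of "- 1"]] l2_finite_range_mult[OF 2 shift[of 1]]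
      l2_finite_range_mult[OF 3 l2_summable_sq[of u]]
    by (subst Abs_l2_inverse) (auto intro!: l2_add_aux)
qed

definition X_domain :: "l2 set"
  where "X_domain = {u. (\<lambda>j. (norm (of_int j *s seq_of u j))\<^sup>2) summable_on UNIV}"

definition X_op :: "l2 \<Rightarrow> l2"
  where "X_op u = Abs_l2 (\<lambda>j. of_int j *s seq_of u j)"

text \<open>\<open>exp_op c T\<close> is \<open>e\<^bsup>cT\<^esup>\<close> for a bounded operator \<open>T\<close>.\<close>

definition exp_op :: "complex \<Rightarrow> (l2 \<Rightarrow> l2) \<Rightarrow> l2 \<Rightarrow> l2"
  where "exp_op c T u = (\<Sum>n. (c ^ n / fact n) *\<^sub>C (T ^^ n) u)"

definition bounded_self_adjoint :: "(l2 \<Rightarrow> l2) \<Rightarrow> bool" where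
  "bounded_self_adjoint T \<longleftrightarrow>
    bounded_linear T \<and> (\<forall>c u. T (c *\<^sub>C u) = c *\<^sub>C T u) \<and> (\<forall>u w. cinner (T u) w = cinner u (T w))"

definition is_asymptotic_velocity :: "(l2 \<Rightarrow> l2) \<Rightarrow> (l2 \<Rightarrow> l2) \<Rightarrow> bool" where
  "is_asymptotic_velocity M Q \<longleftrightarrow> bounded_self_adjoint Q \<and>
    (\<forall>\<psi>\<in>X_domain.
      ((\<lambda>t::real. (1 / t) *\<^sub>R
          exp_op (\<i> * of_real t) M (X_op (exp_op (- \<i> * of_real t) M \<psi>)))
        \<longlongrightarrow> Q \<psi>) at_top)"

section \<open>Local algebras of the spin chain\<close>

text \<open>The product basis of \<open>\<Otimes>\<^bsub>j\<in>S\<^esub> \<complex>\<^sup>2\<close> is indexed by the configurations \<open>S \<rightarrow> {1, 2}\<close>; an operator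
  on this space is given by its matrix in that basis. Configurations are \<^const>\<open>undefined\<close>
  off \<open>S\<close>, and matrices are zero off the configurations, so that both are represented uniquely.\<close>

type_synonym configuration = "int \<Rightarrow> 2"
type_synonym operator = "configuration \<Rightarrow> configuration \<Rightarrow> complex"

definition confs :: "int set \<Rightarrow> configuration set"
  where "confs S = (S \<rightarrow>\<^sub>E UNIV)"

definition local_algebra :: "int set \<Rightarrow> operator set"
  where "local_algebra S = {A. \<forall>s s'. s \<notin> confs S \<or> s' \<notin> confs S \<longrightarrow> A s s' = 0}"

definition op_one :: "int set \<Rightarrow> operator"
  where "op_one S s s' = (if s \<in> confs S \<and> s' = s then 1 else 0)"

definition op_mult :: "int set \<Rightarrow> operator \<Rightarrow> operator \<Rightarrow> operator"
  where "op_mult S A B s s' = (\<Sum>r\<in>confs S. A s r * B r s')"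

definition op_apply :: "int set \<Rightarrow> operator \<Rightarrow> (configuration \<Rightarrow> complex) \<Rightarrow> configuration \<Rightarrow> complex"
  where "op_apply S A \<psi> s = (\<Sum>r\<in>confs S. A s r * \<psi> r)"

definition vec_norm :: "int set \<Rightarrow> (configuration \<Rightarrow> complex) \<Rightarrow> real"
  where "vec_norm S \<psi> = L2_set (\<lambda>s. cmod (\<psi> s)) (confs S)"

definition op_norm :: "int set \<Rightarrow> operator \<Rightarrow> real"
  where "op_norm S A = (SUP \<psi>\<in>{\<psi>. vec_norm S \<psi> \<le> 1}. vec_norm S (op_apply S A \<psi>))"

definition commutator :: "int set \<Rightarrow> operator \<Rightarrow> operator \<Rightarrow> operator"
  where "commutator S A B s s' = op_mult S A B s s' - op_mult S B A s s'"

definition op_exp :: "int set \<Rightarrow> complex \<Rightarrow> operator \<Rightarrow> operator" \<comment> \<open>\<open>e\<^bsup>cA\<^esup>\<close>\<close>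
  where "op_exp S c A s s' = (\<Sum>n. c ^ n / fact n * (op_mult S A ^^ n) (op_one S) s s')"

text \<open>The inclusion \<open>A \<mapsto> A \<otimes> I\<close> of the algebra of \<open>S\<close> into the algebra of \<open>\<Lambda> \<supseteq> S\<close>.\<close>

definition embed :: "int set \<Rightarrow> int set \<Rightarrow> operator \<Rightarrow> operator" where
  "embed \<Lambda> S A s s' =
    (if s \<in> confs \<Lambda> \<and> s' \<in> confs \<Lambda> \<and> (\<forall>j\<in>\<Lambda> - S. s j = s' j)
     then A (restrict s S) (restrict s' S) else 0)"

definition supp :: "int set \<Rightarrow> operator \<Rightarrow> int set"
  where "supp \<Lambda> A = (LEAST S. S \<subseteq> \<Lambda> \<and> A \<in> embed \<Lambda> S ` local_algebra S)"

definition site_dist :: "int set \<Rightarrow> int set \<Rightarrow> int"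
  where "site_dist S1 S2 = Min ((\<lambda>(i, j). \<bar>i - j\<bar>) ` (S1 \<times> S2))"

text \<open>Scalars have empty support, for which \<open>max\<close>, \<open>min\<close> and the distance are not defined;
  such operators, which commute with everything, are left out.\<close>

definition D_pairs :: "int set \<Rightarrow> (operator \<times> operator) set" where
  "D_pairs \<Lambda> = {(A, B). A \<in> local_algebra \<Lambda> \<and> B \<in> local_algebra \<Lambda> \<and>
    supp \<Lambda> A \<noteq> {} \<and> supp \<Lambda> B \<noteq> {} \<and> Max (supp \<Lambda> A) < Min (supp \<Lambda> B)}"

section \<open>The XY chain\<close>

definition pauli_x :: "complex ^ 2 ^ 2"
  where "pauli_x = vector [vector [0, 1], vector [1, 0]]"

definition pauli_y :: "complex ^ 2 ^ 2"
  where "pauli_y = vector [vector [0, - \<i>], vector [\<i>, 0]]"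

definition pauli_z :: "complex ^ 2 ^ 2"
  where "pauli_z = vector [vector [1, 0], vector [0, - 1]]"

definition one_site :: "int \<Rightarrow> complex ^ 2 ^ 2 \<Rightarrow> operator"
  where "one_site j a s s' = (if s \<in> confs {j} \<and> s' \<in> confs {j} then a $ s j $ s' j else 0)"

definition at_site :: "int set \<Rightarrow> int \<Rightarrow> complex ^ 2 ^ 2 \<Rightarrow> operator"
  where "at_site \<Lambda> j a = embed \<Lambda> {j} (one_site j a)"

definition hamiltonian ::
    "(int \<Rightarrow> real) \<Rightarrow> (int \<Rightarrow> real) \<Rightarrow> (int \<Rightarrow> real) \<Rightarrow> int \<Rightarrow> int \<Rightarrow> operator" where
  "hamiltonian \<mu> \<gamma> \<nu> m n s s' = (let \<Lambda> = {m..n} in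
     (\<Sum>j\<in>{m..<n}. of_real (\<mu> j) *
        (of_real (1 + \<gamma> j) * op_mult \<Lambda> (at_site \<Lambda> j pauli_x) (at_site \<Lambda> (j + 1) pauli_x) s s'
       + of_real (1 - \<gamma> j) * op_mult \<Lambda> (at_site \<Lambda> j pauli_y) (at_site \<Lambda> (j + 1) pauli_y) s s'))
   + (\<Sum>j\<in>{m..n}. of_real (\<nu> j) * at_site \<Lambda> j pauli_z s s'))"

definition evolve ::
    "(int \<Rightarrow> real) \<Rightarrow> (int \<Rightarrow> real) \<Rightarrow> (int \<Rightarrow> real) \<Rightarrow> int \<Rightarrow> int \<Rightarrow> real \<Rightarrow> operator \<Rightarrow> operator" where
  "evolve \<mu> \<gamma> \<nu> m n t A = (let \<Lambda> = {m..n}; H = hamiltonian \<mu> \<gamma> \<nu> m n in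
     op_mult \<Lambda> (op_exp \<Lambda> (\<i> * of_real t) H) (op_mult \<Lambda> A (op_exp \<Lambda> (- \<i> * of_real t) H)))"

end

theory Submission
  imports Defs
begin

text \<open>
  The Jordan--Wigner transformation turns the chain into free fermions: the commutator of
  \<open>H\<^sup>(\<^sup>\<Lambda>\<^sup>)\<close> with the fermion field \<open>\<Sum>\<^sub>l (w\<^sub>l\<^sub>1 c\<^sub>l + w\<^sub>l\<^sub>2 c\<^sub>l\<^sup>*)\<close> is minus the field
  of \<open>Mw\<close>, where \<open>M\<close> is the block Jacobi matrix cut off to \<open>\<Lambda>\<close>. Hence \<open>c\<^sub>j\<close> evolves into the field of
  \<open>e\<^bsup>-itM\<^esup>\<delta>\<^sub>j\<close>. The operator \<open>c\<^sub>j\<close> is supported in \<open>[m, j]\<close>, and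
  for \<open>k > j\<close> the commutator with \<open>\<sigma>\<^sup>(\<^sup>z\<^sup>)\<^sub>k\<close> singles out the component at \<open>k\<close> of the field, all other strings
  commuting with \<open>\<sigma>\<^sup>(\<^sup>z\<^sup>)\<^sub>k\<close>. So the Lieb--Robinson bound is an exponential bound on the entries
  of \<open>e\<^bsup>-itM\<^esup>\<close> between \<open>j\<close> and \<open>k\<close>, uniform in \<open>\<Lambda>\<close>, which survives the limit \<open>\<Lambda> \<rightarrow> \<int>\<close>. For a finitely
  supported \<open>\<psi>\<close> it confines \<open>e\<^bsup>-itM\<^esup>\<psi>\<close> to \<open>|k| \<le> (v + \<epsilon>)t\<close> up to an exponentially small tail, whence
  \<open>\<parallel>X e\<^bsup>-itM\<^esup>\<psi>\<parallel>\<^sup>2 \<le> ((v + \<epsilon>)t)\<^sup>2\<parallel>\<psi>\<parallel>\<^sup>2 + O(1)\<close>. As \<open>e\<^bsup>itM\<^esup>\<close> is an isometry, \<open>\<parallel>Q\<psi>\<parallel> \<le> v\<parallel>\<psi>\<parallel>\<close>,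
  and such \<open>\<psi>\<close> are dense.
\<close>

subsection \<open>Power series of the Heisenberg evolution\<close>

lemma op_mult_assoc: "op_mult S (op_mult S A B) C = op_mult S A (op_mult S B C)"
  by (intro ext) (simp add: op_mult_def sum_distrib_left sum_distrib_right mult.assoc,
      rule sum.swap)

lemma op_mult_sum_left:
  "op_mult S (\<lambda>s s'. \<Sum>i\<in>I. c i * A i s s') B s s' = (\<Sum>i\<in>I. c i * op_mult S (A i) B s s')"
  unfolding op_mult_def sum_distrib_left sum_distrib_right mult.assoc by (rule sum.swap)

lemma op_mult_sum_right:
  "op_mult S A (\<lambda>s s'. \<Sum>i\<in>I. c i * B i s s') s s' = (\<Sum>i\<in>I. c i * op_mult S A (B i) s s')"
  unfolding op_mult_def sum_distrib_left sum_distrib_right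
  by (subst sum.swap) (simp add: ac_simps)

lemma finite_confs: "finite S \<Longrightarrow> finite (confs S)"
  unfolding confs_def by (rule finite_PiE) auto

lemma op_mult_one_left:
  assumes "finite S" "A \<in> local_algebra S" shows "op_mult S (op_one S) A = A"
proof (intro ext)
  fix s s'
  have "op_mult S (op_one S) A s s' = (\<Sum>r\<in>confs S. if r = s then A s s' else 0)"
    unfolding op_mult_def op_one_def by (intro sum.cong) auto
  also have "\<dots> = A s s'"
    using assms by (auto simp: finite_confs local_algebra_def)
  finally show "op_mult S (op_one S) A s s' = A s s'" .
qed

lemma op_mult_one_right:
  assumes "finite S" "A \<in> local_algebra S" shows "op_mult S A (op_one S) = A"
proof (intro ext)
  fix s s'
  have "op_mult S A (op_one S) s s' = (\<Sum>r\<in>confs S. if r = s' then A s s' else 0)"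
    unfolding op_mult_def op_one_def by (intro sum.cong) auto
  also have "\<dots> = A s s'"
    using assms by (auto simp: finite_confs local_algebra_def)
  finally show "op_mult S A (op_one S) s s' = A s s'" .
qed

abbreviation op_pow :: "int set \<Rightarrow> operator \<Rightarrow> nat \<Rightarrow> operator"
  where "op_pow S H n \<equiv> (op_mult S H ^^ n) (op_one S)"

lemma op_pow_commute:
  assumes "finite S" "H \<in> local_algebra S"
  shows "op_mult S (op_pow S H n) H = op_pow S H (Suc n)"
  by (induction n) (simp_all add: op_mult_one_left op_mult_one_right assms op_mult_assoc)


text \<open>Each further factor \<open>H\<close> costs at most \<open>card (confs S)\<close> times
  the sum of the moduli of all entries of \<open>H\<close>. Geometric growth of the entries is all
  that the exponential series needs.\<close>

lemma op_pow_bound: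
  assumes "finite S"
  obtains K where "\<And>n s r. s \<in> confs S \<Longrightarrow> cmod (op_pow S H n s r) \<le> K ^ n"
proof -
  have fin: "finite (confs S)" by (rule finite_confs[OF assms])
  define b where "b = (\<Sum>s\<in>confs S. \<Sum>r\<in>confs S. cmod (H s r))"
  have b: "cmod (H s r) \<le> b" if "s \<in> confs S" "r \<in> confs S" for s r
  proof -
    have "cmod (H s r) \<le> (\<Sum>r\<in>confs S. cmod (H s r))"
      by (rule member_le_sum) (auto simp: that fin)
    also have "\<dots> \<le> b"
      unfolding b_def by (rule member_le_sum) (auto simp: that fin sum_nonneg)
    finally show ?thesis .
  qed
  have *: "cmod (op_pow S H n s r) \<le> (real (card (confs S)) * b) ^ n" if "s \<in> confs S" for n s r
    using that
  proof (induction n arbitrary: s)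
    case (Suc n)
    have "cmod (op_pow S H (Suc n) s r) \<le> (\<Sum>q\<in>confs S. cmod (H s q) * cmod (op_pow S H n q r))"
      by (auto simp: op_mult_def norm_mult intro!: sum_norm_le)
    also have "\<dots> \<le> (\<Sum>q\<in>confs S. b * (real (card (confs S)) * b) ^ n)"
      using Suc b by (intro sum_mono mult_mono) (auto simp: b_def sum_nonneg)
    finally show ?case by (simp add: mult_ac)
  qed (simp add: op_one_def)
  then show thesis by (rule that)
qed

lemma summable_op_exp:
  assumes "finite S" "s \<in> confs S"
  shows "summable (\<lambda>n. cmod (c ^ n / fact n * op_pow S H n s r))"
proof -
  obtain K where K: "\<And>n s r. s \<in> confs S \<Longrightarrow> cmod (op_pow S H n s r) \<le> K ^ n"
    using op_pow_bound[OF assms(1), of H] by blast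
  show ?thesis
  proof (rule summable_comparison_test')
    show "summable (\<lambda>n. inverse (fact n) * (cmod c * K) ^ n)"
      by (rule summable_exp)
    show "norm (cmod (c ^ n / fact n * op_pow S H n s r)) \<le> inverse (fact n) * (cmod c * K) ^ n"
      for n
      using mult_left_mono[OF K[OF assms(2), of n r], of "cmod c ^ n / fact n"]
      by (simp add: norm_mult norm_divide norm_power power_mult_distrib divide_simps mult_ac)
  qed
qed

text \<open>The coefficient of c^n in e^{cH} A e^{-cH}, that is the n-fold commutator ad_H^n(A)
  divided by n!. It is written as a Cauchy product coefficient of the two exponential
  series.\<close>

definition dyson_coeff :: "int set \<Rightarrow> operator \<Rightarrow> operator \<Rightarrow> nat \<Rightarrow> operator" where
  "dyson_coeff S H A n s s' = (\<Sum>p\<le>n. ((- 1) ^ (n - p) / (fact p * fact (n - p))) *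
     op_mult S (op_pow S H p) (op_mult S A (op_pow S H (n - p))) s s')"

lemma dyson_coeff_0:
  assumes "finite S" "A \<in> local_algebra S"
  shows "dyson_coeff S H A 0 = A"
  by (intro ext) (simp add: dyson_coeff_def op_mult_one_right op_mult_one_left assms)

text \<open>A factor \<open>H\<close> on the left raises the left power, one on the right the right
  power. After reindexing, the two sums carry the weights \<open>p\<close> and
  \<open>Suc n - p\<close>, which add up to \<open>Suc n\<close>.\<close>

lemma commutator_dyson_coeff:
  assumes "finite S" "H \<in> local_algebra S"
  shows "commutator S H (dyson_coeff S H A n) s s' = of_nat (Suc n) * dyson_coeff S H A (Suc n) s s'"
proof -
  define a :: "nat \<Rightarrow> nat \<Rightarrow> complex" where "a p q = (- 1) ^ q / (fact p * fact q)" for p q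
  define W where "W p q = op_mult S (op_pow S H p) (op_mult S A (op_pow S H q)) s s'" for p q
  have a: "of_nat (Suc p) * a (Suc p) q = a p q" "of_nat (Suc q) * a p (Suc q) = - a p q" for p q
    by (simp_all add: a_def divide_simps del: of_nat_Suc)
  have a': "of_nat (Suc n - p) * a p (Suc n - p) = - a p (n - p)" if "p \<le> n" for p
    using a(2)[of "n - p" p] that by (simp only: Suc_diff_le)
  have D: "dyson_coeff S H A n = (\<lambda>s s'. \<Sum>p\<le>n. a p (n - p) *
     op_mult S (op_pow S H p) (op_mult S A (op_pow S H (n - p))) s s')" for n
    by (intro ext) (simp add: dyson_coeff_def a_def)
  have "commutator S H (dyson_coeff S H A n) s s'
      = (\<Sum>p\<le>n. a p (n - p) * W (Suc p) (n - p)) - (\<Sum>p\<le>n. a p (n - p) * W p (Suc (n - p)))"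
    unfolding commutator_def D op_mult_sum_left op_mult_sum_right W_def
    using op_pow_commute[OF assms] by (simp add: op_mult_assoc)
  also have "(\<Sum>p\<le>n. a p (n - p) * W p (Suc (n - p))) = (\<Sum>p\<le>n. a p (n - p) * W p (Suc n - p))"
    by (rule sum.cong[OF refl]) (simp only: Suc_diff_le atMost_iff)
  \<comment> \<open>Shift of \<open>p\<close> by one; the new summand at 0 carries the weight
    0.\<close>
  also have "(\<Sum>p\<le>n. a p (n - p) * W (Suc p) (n - p))
      = (\<Sum>p\<le>Suc n. of_nat p * a p (Suc n - p) * W p (Suc n - p))"
    by (subst sum.atMost_Suc_shift) (simp add: a del: of_nat_Suc)
  \<comment> \<open>The additional summand at \<open>Suc n\<close> has weight 0 as well.\<close>
  also have "(\<Sum>p\<le>n. a p (n - p) * W p (Suc n - p))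
      = - (\<Sum>p\<le>Suc n. of_nat (Suc n - p) * a p (Suc n - p) * W p (Suc n - p))"
    by (simp only: sum.atMost_Suc diff_self_eq_0 of_nat_0 mult_zero_left add_0_right
        sum_negf[symmetric])
      (rule sum.cong[OF refl], simp only: a' atMost_iff mult_minus_left minus_minus)
  also have "(\<Sum>p\<le>Suc n. of_nat p * a p (Suc n - p) * W p (Suc n - p))
      - - (\<Sum>p\<le>Suc n. of_nat (Suc n - p) * a p (Suc n - p) * W p (Suc n - p))
      = (\<Sum>p\<le>Suc n. of_nat (p + (Suc n - p)) * (a p (Suc n - p) * W p (Suc n - p)))"
    unfolding of_nat_add by (simp only: diff_minus_eq_add sum.distrib[symmetric] distrib_right mult.assoc)
  also have "\<dots> = (\<Sum>p\<le>Suc n. of_nat (Suc n) * (a p (Suc n - p) * W p (Suc n - p)))"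
    by (intro sum.cong) auto
  also have "\<dots> = of_nat (Suc n) * dyson_coeff S H A (Suc n) s s'"
    by (simp only: D W_def sum_distrib_left)
  finally show ?thesis .
qed

text \<open>Each entry is a finite sum, over two intermediate configurations, of products of
  absolutely convergent series, so the Cauchy product applies entry by entry.\<close>

lemma heisenberg_sums:
  assumes "finite S" "H \<in> local_algebra S" "s \<in> confs S"
  shows "(\<lambda>n. c ^ n * dyson_coeff S H A n s s') sums
    op_mult S (op_exp S c H) (op_mult S A (op_exp S (- c) H)) s s'"
proof -
  define u where "u n s r = c ^ n / fact n * op_pow S H n s r" for n s r
  define w where "w n s r = (- c) ^ n / fact n * op_pow S H n s r" for n s r
  have "(\<lambda>n. \<Sum>r\<in>confs S. \<Sum>q\<in>confs S. A r q * (\<Sum>p\<le>n. u p s r * w (n - p) q s'))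
      sums (\<Sum>r\<in>confs S. \<Sum>q\<in>confs S. A r q * ((\<Sum>p. u p s r) * (\<Sum>p. w p q s')))"
    unfolding u_def w_def
    by (intro sums_sum sums_mult Cauchy_product_sums summable_op_exp assms)
  also have "(\<Sum>r\<in>confs S. \<Sum>q\<in>confs S. A r q * ((\<Sum>p. u p s r) * (\<Sum>p. w p q s')))
     = op_mult S (op_exp S c H) (op_mult S A (op_exp S (- c) H)) s s'"
    by (simp add: op_mult_def op_exp_def u_def w_def sum_distrib_left mult_ac)
  also have "(\<lambda>n. \<Sum>r\<in>confs S. \<Sum>q\<in>confs S. A r q * (\<Sum>p\<le>n. u p s r * w (n - p) q s'))
      = (\<lambda>n. c ^ n * dyson_coeff S H A n s s')"
  proof
    fix n
    have uw: "u p s r * w (n - p) q s' = c ^ n * ((- 1) ^ (n - p) / (fact p * fact (n - p)) *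
        (op_pow S H p s r * op_pow S H (n - p) q s'))" if "p \<le> n" for p r q
    proof -
      have "c ^ n = c ^ p * c ^ (n - p)" using that by (simp add: power_add[symmetric])
      moreover have "(- c) ^ (n - p) = (- 1) ^ (n - p) * c ^ (n - p)" by (rule power_minus)
      ultimately show ?thesis by (simp add: u_def w_def)
    qed
    have "(\<Sum>r\<in>confs S. \<Sum>q\<in>confs S. A r q * (\<Sum>p\<le>n. u p s r * w (n - p) q s'))
      = (\<Sum>r\<in>confs S. \<Sum>q\<in>confs S. \<Sum>p\<le>n. c ^ n * ((- 1) ^ (n - p) / (fact p * fact (n - p)) *
        (op_pow S H p s r * (A r q * op_pow S H (n - p) q s'))))"
      by (simp add: uw sum_distrib_left mult_ac)
    also have "\<dots> = (\<Sum>p\<le>n. \<Sum>r\<in>confs S. \<Sum>q\<in>confs S. c ^ n * ((- 1) ^ (n - p) / (fact p * fact (n - p)) *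
        (op_pow S H p s r * (A r q * op_pow S H (n - p) q s'))))"
      by (subst sum.swap, subst sum.swap) (rule refl)
    also have "\<dots> = c ^ n * dyson_coeff S H A n s s'"
      by (simp add: dyson_coeff_def op_mult_def sum_distrib_left)
    finally show "(\<Sum>r\<in>confs S. \<Sum>q\<in>confs S. A r q * (\<Sum>p\<le>n. u p s r * w (n - p) q s'))
      = c ^ n * dyson_coeff S H A n s s'" .
  qed
  finally show ?thesis .
qed

subsection \<open>Monomial operators and the Jordan--Wigner transformation\<close>

text \<open>The operator sending psi to the vector with value \<open>a s * psi (F s)\<close> at
  \<open>s\<close>. Pauli matrices and Jordan-Wigner fermions all have this shape, which reduces
  products to compositions of maps and products of weights.\<close>

definition monomial :: "int set \<Rightarrow> (configuration \<Rightarrow> configuration) \<Rightarrow> (configuration \<Rightarrow> complex) \<Rightarrow> operator"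
  where "monomial S F a s s' = (if s \<in> confs S \<and> s' = F s then a s else 0)"

lemma monomial_mult:
  assumes "finite S" "F ` confs S \<subseteq> confs S"
  shows "op_mult S (monomial S F a) (monomial S G b) = monomial S (G \<circ> F) (\<lambda>s. a s * b (F s))"
proof (intro ext)
  fix s s'
  have "op_mult S (monomial S F a) (monomial S G b) s s'
      = (\<Sum>r\<in>confs S. if r = F s then (if s \<in> confs S then a s * monomial S G b (F s) s' else 0) else 0)"
    unfolding op_mult_def by (intro sum.cong) (auto simp: monomial_def)
  also have "\<dots> = monomial S (G \<circ> F) (\<lambda>s. a s * b (F s)) s s'"
    using assms by (auto simp: finite_confs monomial_def)
  finally show "op_mult S (monomial S F a) (monomial S G b) s s'
    = monomial S (G \<circ> F) (\<lambda>s. a s * b (F s)) s s'" .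
qed

text \<open>When the two maps commute, both products are monomial over the same map, hence so is
  their difference. The common map is a free \<open>E\<close> so that a simplified form of the
  composition can be supplied.\<close>

lemma commutator_monomial:
  assumes "finite S" "F ` confs S \<subseteq> confs S" "G ` confs S \<subseteq> confs S" "G \<circ> F = E" "F \<circ> G = E"
  shows "commutator S (monomial S F a) (monomial S G b) = monomial S E (\<lambda>s. a s * b (F s) - b s * a (G s))"
  unfolding commutator_def monomial_mult[OF assms(1,2)] monomial_mult[OF assms(1,3)] assms(4,5)
  by (auto simp: monomial_def fun_eq_iff)

definition other :: "2 \<Rightarrow> 2" where "other x = (if x = 1 then 2 else 1)"

definition spin :: "2 \<Rightarrow> complex" where "spin x = (if x = 1 then 1 else - 1)"

definition flip :: "int \<Rightarrow> configuration \<Rightarrow> configuration"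
  where "flip j s = s(j := other (s j))"

lemma other_simps [simp]: "other 1 = 2" "other 2 = 1" "other (other x) = x" "other x \<noteq> x" "x \<noteq> other x"
  "spin 1 = 1" "spin 2 = - 1" "spin (other x) = - spin x" "spin x * spin x = 1" "cmod (spin x) = 1"
  using exhaust_2[of x] by (auto simp: other_def spin_def)

lemma flip_simps [simp]:
  "flip j s j = other (s j)" "i \<noteq> j \<Longrightarrow> flip j s i = s i" "flip j (flip j s) = s"
  by (auto simp: flip_def)

lemma flip_commute: "flip i (flip j s) = flip j (flip i s)"
  by (auto simp: flip_def fun_eq_iff)

lemma flip_image_confs: "j \<in> S \<Longrightarrow> flip j ` confs S \<subseteq> confs S"
  by (auto simp: flip_def confs_def PiE_iff extensional_def)

text \<open>The Jordan-Wigner string: the diagonal entry at \<open>s\<close> of the product of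
  sigma^z over the sites m, ..., j - 1.\<close>

definition string :: "int \<Rightarrow> int \<Rightarrow> configuration \<Rightarrow> complex"
  where "string m j s = (\<Prod>i\<in>{m..<j}. spin (s i))"

lemma string_flip_outside [simp]: "j \<notin> {m..<l} \<Longrightarrow> string m l (flip j s) = string m l s"
  unfolding string_def by (intro prod.cong refl arg_cong[of _ _ spin] flip_simps) auto

text \<open>Exactly one factor of the string changes sign. This is the origin of the fermionic
  signs.\<close>

lemma string_flip_inside [simp]:
  assumes "j \<in> {m..<l}" shows "string m l (flip j s) = - string m l s"
proof -
  have "string m l t = spin (t j) * (\<Prod>i\<in>{m..<l} - {j}. spin (t i))" for t
    unfolding string_def by (rule prod.remove) (use assms in auto)
  moreover have "(\<Prod>i\<in>{m..<l} - {j}. spin (flip j s i)) = (\<Prod>i\<in>{m..<l} - {j}. spin (s i))"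
    by (intro prod.cong) auto
  ultimately show ?thesis by simp
qed

lemma string_Suc: "m \<le> j \<Longrightarrow> string m (j + 1) s = string m j s * spin (s j)"
proof -
  assume "m \<le> j"
  then have "{m..<j + 1} = insert j {m..<j}" by auto
  then show ?thesis by (simp add: string_def)
qed

lemma norm_string [simp]: "cmod (string m j s) = 1"
  by (simp add: string_def prod_norm[symmetric])

text \<open>\<open>fermion m n j x\<close> is \<open>x\<^sub>1 c\<^sub>j + x\<^sub>2 c\<^sub>j\<^sup>*\<close>.\<close>

definition fermion :: "int \<Rightarrow> int \<Rightarrow> int \<Rightarrow> complex ^ 2 \<Rightarrow> operator"
  where "fermion m n j x = monomial {m..n} (flip j) (\<lambda>s. string m j s * x $ other (s j))"

text \<open>The bond term of the Hamiltonian: both Pauli products flip the spins at j and j + 1, and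
  the two factors -i of sigma^y produce the minus sign in front of
  \<open>1 - \<gamma> j\<close>.\<close>

definition hopping :: "(int \<Rightarrow> real) \<Rightarrow> (int \<Rightarrow> real) \<Rightarrow> int \<Rightarrow> int \<Rightarrow> int \<Rightarrow> operator"
  where "hopping \<mu> \<gamma> m n j = monomial {m..n} (flip (j + 1) \<circ> flip j)
    (\<lambda>s. of_real (\<mu> j) * (of_real (1 + \<gamma> j) - of_real (1 - \<gamma> j) * spin (s j) * spin (s (j + 1))))"

definition z_at :: "int \<Rightarrow> int \<Rightarrow> int \<Rightarrow> operator"
  where "z_at m n j = monomial {m..n} id (\<lambda>s. spin (s j))"

section \<open>Commutators of the Hamiltonian terms with a single fermion\<close>

text \<open>A string ending before the bond meets neither flip, one passing over the bond meets
  both, and then the two signs cancel. The bond weight does not see the flip at l.\<close>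

lemma commutator_hopping_far:
  assumes "j \<in> {m..<n}" "l \<in> {m..n}" "l \<noteq> j" "l \<noteq> j + 1"
  shows "commutator {m..n} (hopping \<mu> \<gamma> m n j) (fermion m n l x) = (\<lambda>s s'. 0)"
proof -
  have st: "string m l (flip (j + 1) (flip j s)) = string m l s"
    "string m l (flip j (flip (j + 1) s)) = string m l s" for s
    using assms by (cases "j < l"; auto)+
  show ?thesis
    unfolding hopping_def fermion_def
    apply (subst commutator_monomial[OF _ _ _ refl])
    using assms flip_image_confs[of j "{m..n}"] flip_image_confs[of "j + 1" "{m..n}"] flip_image_confs[of l "{m..n}"]
    apply (auto simp: fun_eq_iff flip_commute st monomial_def image_subset_iff)
    done
qed

text \<open>The two flips at j cancel and leave one at j + 1. The string of a fermion there is
  longer by one site, and the missing factor \<open>spin (s j)\<close> comes out of the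
  weights.\<close>

lemma commutator_hopping_left:
  assumes "j \<in> {m..<n}"
  shows "commutator {m..n} (hopping \<mu> \<gamma> m n j) (fermion m n j x)
    = fermion m n (j + 1) (- (conj_transpose (\<Gamma>_block \<mu> \<gamma> (j + 1)) *v x))"
proof -
  have "commutator {m..n} (hopping \<mu> \<gamma> m n j) (fermion m n j x) = monomial {m..n} (flip (j + 1))
     (\<lambda>s. of_real (\<mu> j) * (of_real (1 + \<gamma> j) - of_real (1 - \<gamma> j) * spin (s j) * spin (s (j + 1))) *
         (string m j s * x $ s j)
       - string m j s * x $ other (s j) *
         (of_real (\<mu> j) * (of_real (1 + \<gamma> j) + of_real (1 - \<gamma> j) * spin (s j) * spin (s (j + 1)))))"
    unfolding hopping_def fermion_def
    apply (subst commutator_monomial[where E = "flip (j + 1)"])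
    using assms flip_image_confs[of j "{m..n}"] flip_image_confs[of "j + 1" "{m..n}"]
    apply (auto simp: fun_eq_iff flip_commute monomial_def image_subset_iff)
    done
  also have "\<dots> = fermion m n (j + 1) (- (conj_transpose (\<Gamma>_block \<mu> \<gamma> (j + 1)) *v x))"
  proof -
    \<comment> \<open>Here \<open>a\<close> and \<open>b\<close> stand for the values of the
      configuration at j and j + 1, and \<open>c\<close> for the string up to j; the four cases are
      checked directly.\<close>
    have "of_real (\<mu> j) * (of_real (1 + \<gamma> j) - of_real (1 - \<gamma> j) * spin a * spin b) * (c * x $ a)
       - c * x $ other a * (of_real (\<mu> j) * (of_real (1 + \<gamma> j) + of_real (1 - \<gamma> j) * spin a * spin b))
     = c * spin a * ((- (conj_transpose (\<Gamma>_block \<mu> \<gamma> (j + 1)) *v x)) $ other b)" for a b c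
      using exhaust_2[of a] exhaust_2[of b]
      by (auto simp: \<Gamma>_block_def conj_transpose_def matrix_vector_mult_def sum_2 algebra_simps)
    then show ?thesis
      unfolding fermion_def using assms by (simp add: string_Suc)
  qed
  finally show ?thesis .
qed

text \<open>Now j lies inside the string, whence the sign of the first product. The last factor
  \<open>spin (s j)\<close> of the string is absorbed by the weights, which shortens the string by
  one site.\<close>

lemma commutator_hopping_right:
  assumes "j \<in> {m..<n}"
  shows "commutator {m..n} (hopping \<mu> \<gamma> m n j) (fermion m n (j + 1) x)
    = fermion m n j (- (\<Gamma>_block \<mu> \<gamma> (j + 1) *v x))"
proof -
  have "commutator {m..n} (hopping \<mu> \<gamma> m n j) (fermion m n (j + 1) x) = monomial {m..n} (flip j)
     (\<lambda>s. - (of_real (\<mu> j) * (of_real (1 + \<gamma> j) - of_real (1 - \<gamma> j) * spin (s j) * spin (s (j + 1))) *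
         (string m (j + 1) s * x $ s (j + 1)))
       - string m (j + 1) s * x $ other (s (j + 1)) *
         (of_real (\<mu> j) * (of_real (1 + \<gamma> j) + of_real (1 - \<gamma> j) * spin (s j) * spin (s (j + 1)))))"
    unfolding hopping_def fermion_def
    apply (subst commutator_monomial[where E = "flip j"])
    using assms flip_image_confs[of j "{m..n}"] flip_image_confs[of "j + 1" "{m..n}"]
    apply (auto simp: fun_eq_iff flip_commute monomial_def image_subset_iff)
    done
  also have "\<dots> = fermion m n j (- (\<Gamma>_block \<mu> \<gamma> (j + 1) *v x))"
  proof -
    have "- (of_real (\<mu> j) * (of_real (1 + \<gamma> j) - of_real (1 - \<gamma> j) * spin a * spin b) * (c * spin a * x $ b))
       - c * spin a * x $ other b * (of_real (\<mu> j) * (of_real (1 + \<gamma> j) + of_real (1 - \<gamma> j) * spin a * spin b))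
     = c * ((- (\<Gamma>_block \<mu> \<gamma> (j + 1) *v x)) $ other a)" for a b c
      using exhaust_2[of a] exhaust_2[of b]
      by (auto simp: \<Gamma>_block_def matrix_vector_mult_def sum_2 algebra_simps)
    then show ?thesis
      unfolding fermion_def using assms by (simp add: string_Suc)
  qed
  finally show ?thesis .
qed

text \<open>The weights of sigma^z_k at \<open>s\<close> and at \<open>flip l s\<close> differ only
  if k = l, and then by twice the spin.\<close>

lemma commutator_z_at:
  assumes "k \<in> {m..n}" "l \<in> {m..n}"
  shows "commutator {m..n} (z_at m n k) (fermion m n l x)
    = (if k = l then fermion m n l (\<chi> a. - 2 * spin a * x $ a) else (\<lambda>s s'. 0))"
proof -
  have "commutator {m..n} (z_at m n k) (fermion m n l x) = monomial {m..n} (flip l)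
     (\<lambda>s. (spin (s k) - spin (flip l s k)) * (string m l s * x $ other (s l)))"
    unfolding z_at_def fermion_def
    apply (subst commutator_monomial[where E = "flip l"])
    using assms flip_image_confs[of l "{m..n}"]
    apply (auto simp: fun_eq_iff monomial_def algebra_simps)
    done
  then show ?thesis by (auto simp: fun_eq_iff fermion_def monomial_def)
qed


text \<open>The right factor is diagonal, so only entries that change the spin at k survive. This is
  how sigma^z_k detects a fermion at k.\<close>

lemma commutator_right_z_at:
  assumes "k \<in> {m..n}" "s \<in> confs {m..n}" "s' \<in> confs {m..n}"
  shows "commutator {m..n} A (z_at m n k) s s' = (spin (s' k) - spin (s k)) * A s s'"
proof -
  have "op_mult {m..n} A (z_at m n k) s s' = (\<Sum>r\<in>confs {m..n}. if r = s' then spin (s' k) * A s s' else 0)"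
    unfolding op_mult_def by (intro sum.cong) (auto simp: z_at_def monomial_def)
  moreover have "op_mult {m..n} (z_at m n k) A s s' = (\<Sum>r\<in>confs {m..n}. if r = s then spin (s k) * A s s' else 0)"
    unfolding op_mult_def by (intro sum.cong) (auto simp: z_at_def monomial_def)
  ultimately show ?thesis
    using assms by (simp add: commutator_def finite_confs algebra_simps)
qed

section \<open>Pauli matrices and the Hamiltonian in terms of monomials\<close>

lemma at_site_apply:
  assumes "j \<in> S"
  shows "at_site S j a s s' = (if s \<in> confs S \<and> s' \<in> confs S \<and> (\<forall>i\<in>S - {j}. s i = s' i) then a $ s j $ s' j else 0)"
  using assms by (auto simp: at_site_def embed_def one_site_def confs_def PiE_iff)

lemma eq_flip_iff:
  assumes "s \<in> confs S" "s' \<in> confs S" "j \<in> S"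
  shows "s' = flip j s \<longleftrightarrow> (\<forall>i\<in>S - {j}. s i = s' i) \<and> s' j \<noteq> s j"
proof -
  have o: "s' j \<noteq> s j \<longleftrightarrow> s' j = other (s j)"
    using exhaust_2[of "s j"] exhaust_2[of "s' j"] by (auto simp: other_def)
  have "s' = flip j s \<longleftrightarrow> (\<forall>i\<in>S. s' i = flip j s i)"
    using assms by (auto simp: fun_eq_iff flip_def confs_def PiE_iff extensional_def)
  then show ?thesis unfolding o using assms by (auto simp: flip_def)
qed

lemma at_site_pauli:
  assumes "j \<in> S"
  shows "at_site S j pauli_x = monomial S (flip j) (\<lambda>s. 1)"
    and "at_site S j pauli_y = monomial S (flip j) (\<lambda>s. - \<i> * spin (s j))"
    and "at_site S j pauli_z = monomial S id (\<lambda>s. spin (s j))"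
proof -
  have mem: "flip j s \<in> confs S" if "s \<in> confs S" for s
    using flip_image_confs[OF assms] that by auto
  have px: "pauli_x $ a $ b = (if b = a then 0 else 1)"
    and py: "pauli_y $ a $ b = (if b = a then 0 else - \<i> * spin a)"
    and pz: "pauli_z $ a $ b = (if b = a then spin a else 0)" for a b
    using exhaust_2[of a] exhaust_2[of b] by (auto simp: pauli_x_def pauli_y_def pauli_z_def)
  have id: "s' = s \<longleftrightarrow> (\<forall>i\<in>S - {j}. s i = s' i) \<and> s' j = s j" if "s \<in> confs S" "s' \<in> confs S" for s s'
  proof
    assume "(\<forall>i\<in>S - {j}. s i = s' i) \<and> s' j = s j"
    then have "s' i = s i" if "i \<in> S" for i using that by (cases "i = j") auto
    then show "s' = s" using that unfolding confs_def by (intro PiE_ext[of s' S _ s])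
  qed auto
  have flip: "monomial S (flip j) b s s' = (if s \<in> confs S \<and> s' \<in> confs S \<and> (\<forall>i\<in>S - {j}. s i = s' i)
      then if s' j = s j then 0 else b s else 0)" for b s s'
  proof (cases "s \<in> confs S \<and> s' \<in> confs S")
    case True
    then show ?thesis using eq_flip_iff[of s S s' j] assms by (simp add: monomial_def)
  next
    case False
    then show ?thesis using mem[of s] by (auto simp: monomial_def)
  qed
  have diag: "monomial S id b s s' = (if s \<in> confs S \<and> s' \<in> confs S \<and> (\<forall>i\<in>S - {j}. s i = s' i)
      then if s' j = s j then b s else 0 else 0)" for b s s'
  proof (cases "s \<in> confs S \<and> s' \<in> confs S")
    case True
    then show ?thesis using id[of s s'] by (simp add: monomial_def)
  next
    case False
    then show ?thesis by (auto simp: monomial_def)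
  qed
  show "at_site S j pauli_x = monomial S (flip j) (\<lambda>s. 1)"
    by (intro ext) (simp only: at_site_apply[OF assms] flip px)
  show "at_site S j pauli_y = monomial S (flip j) (\<lambda>s. - \<i> * spin (s j))"
    by (intro ext) (simp only: at_site_apply[OF assms] flip py)
  show "at_site S j pauli_z = monomial S id (\<lambda>s. spin (s j))"
    by (intro ext) (simp only: at_site_apply[OF assms] diag pz)
qed

lemma hamiltonian_eq:
  "hamiltonian \<mu> \<gamma> \<nu> m n = (\<lambda>s s'. (\<Sum>j\<in>{m..<n}. hopping \<mu> \<gamma> m n j s s')
     + (\<Sum>j\<in>{m..n}. of_real (\<nu> j) * z_at m n j s s'))"
proof -
  have "of_real (\<mu> j) *
        (of_real (1 + \<gamma> j) * op_mult {m..n} (at_site {m..n} j pauli_x) (at_site {m..n} (j + 1) pauli_x) s s'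
       + of_real (1 - \<gamma> j) * op_mult {m..n} (at_site {m..n} j pauli_y) (at_site {m..n} (j + 1) pauli_y) s s')
     = hopping \<mu> \<gamma> m n j s s'" if "j \<in> {m..<n}" for j s s'
    using that flip_image_confs[of j "{m..n}"]
    by (auto simp: at_site_pauli monomial_mult hopping_def) (auto simp: monomial_def algebra_simps)
  then show ?thesis
    unfolding hamiltonian_def Let_def
    by (intro ext arg_cong2[of _ _ _ _ "(+)"] sum.cong) (auto simp: z_at_def at_site_pauli)
qed

lemma monomial_local_algebra:
  "F ` confs S \<subseteq> confs S \<Longrightarrow> monomial S F a \<in> local_algebra S"
  by (auto simp: monomial_def local_algebra_def)

lemma fermion_local_algebra: "j \<in> {m..n} \<Longrightarrow> fermion m n j x \<in> local_algebra {m..n}"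
  unfolding fermion_def by (intro monomial_local_algebra flip_image_confs)

lemma z_at_local_algebra: "z_at m n j \<in> local_algebra {m..n}"
  unfolding z_at_def by (intro monomial_local_algebra) simp

lemma hopping_local_algebra: "j \<in> {m..<n} \<Longrightarrow> hopping \<mu> \<gamma> m n j \<in> local_algebra {m..n}"
  unfolding hopping_def
  using flip_image_confs[of j "{m..n}"] flip_image_confs[of "j + 1" "{m..n}"]
  by (intro monomial_local_algebra) (auto simp: image_subset_iff)

lemma hamiltonian_local_algebra: "hamiltonian \<mu> \<gamma> \<nu> m n \<in> local_algebra {m..n}"
proof -
  have "hopping \<mu> \<gamma> m n j s s' = 0" "z_at m n i s s' = 0"
    if "s \<notin> confs {m..n} \<or> s' \<notin> confs {m..n}" "j \<in> {m..<n}" for i j s s'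
    using that hopping_local_algebra[of j m n] z_at_local_algebra[of m n i] by (auto simp: local_algebra_def)
  moreover have "z_at m n i s s' = 0"
    if "s \<notin> confs {m..n} \<or> s' \<notin> confs {m..n}" for i s s'
    using that z_at_local_algebra[of m n i] by (auto simp: local_algebra_def)
  ultimately show ?thesis
    unfolding hamiltonian_eq local_algebra_def by auto
qed

section \<open>Linear combinations of fermions and the block Jacobi matrix\<close>

definition field :: "int \<Rightarrow> int \<Rightarrow> (int \<Rightarrow> complex ^ 2) \<Rightarrow> operator"
  where "field m n w s s' = (\<Sum>l\<in>{m..n}. fermion m n l (w l) s s')"

text \<open>The action of \<open>M_inf\<close> on arbitrary sequences. Being free of a summability
  condition, it applies to truncated sequences and to the coefficients of a field in finite
  volume.\<close>

definition jacobi :: "(int \<Rightarrow> real) \<Rightarrow> (int \<Rightarrow> real) \<Rightarrow> (int \<Rightarrow> real) \<Rightarrow> (int \<Rightarrow> complex ^ 2) \<Rightarrow> int \<Rightarrow> complex ^ 2"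
  where "jacobi \<mu> \<gamma> \<nu> w j = conj_transpose (\<Gamma>_block \<mu> \<gamma> j) *v w (j - 1)
    + J_block \<nu> j *v w j + \<Gamma>_block \<mu> \<gamma> (j + 1) *v w (j + 1)"

text \<open>\<open>jacobi\<close> after \<open>box_cut\<close> stands for the finite-volume block
  matrix. The outcome may be nonzero next to the box, but neither \<open>field\<close> nor the next
  \<open>box_cut\<close> sees those values.\<close>

definition box_cut :: "int \<Rightarrow> int \<Rightarrow> (int \<Rightarrow> complex ^ 2) \<Rightarrow> int \<Rightarrow> complex ^ 2"
  where "box_cut m n w j = (if j \<in> {m..n} then w j else 0)"

lemma fermion_add: "fermion m n l (x + y) s s' = fermion m n l x s s' + fermion m n l y s s'"
  and fermion_minus: "fermion m n l (- x) s s' = - fermion m n l x s s'"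
  and fermion_0: "fermion m n l 0 s s' = 0"
  and fermion_scale: "fermion m n l (c *s x) s s' = c * fermion m n l x s s'"
  by (auto simp: fermion_def monomial_def algebra_simps)

text \<open>A fermion at j arises from the two bonds meeting at j and from the sigma^z term at j;
  these supply the three blocks of row j. At the ends of the chain one bond is missing, which the
  cut accounts for.\<close>

lemma commutator_hamiltonian_field:
  "commutator {m..n} (hamiltonian \<mu> \<gamma> \<nu> m n) (field m n w) s s' = - field m n (jacobi \<mu> \<gamma> \<nu> (box_cut m n w)) s s'"
proof -
  let ?C = "\<lambda>A B. commutator {m..n} A B s s'"
  have L: "?C (\<lambda>s s'. (\<Sum>j\<in>I. A j s s') + (\<Sum>j\<in>K. c j * B j s s')) X
      = (\<Sum>j\<in>I. ?C (A j) X) + (\<Sum>j\<in>K. c j * ?C (B j) X)" for I K :: "int set" and A c B X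
    unfolding commutator_def op_mult_def
    by (simp add: distrib_left distrib_right sum.distrib sum_distrib_left sum_distrib_right sum_subtractf
       right_diff_distrib mult_ac sum.swap[of _ _ "confs _"])
  have R: "?C X (\<lambda>s s'. (\<Sum>j\<in>I. A j s s')) = (\<Sum>j\<in>I. ?C X (A j))" for I :: "int set" and A X
    unfolding commutator_def op_mult_def
    by (simp add: sum_distrib_left sum_distrib_right sum_subtractf mult_ac sum.swap[of _ _ "confs _"])
  have hop: "?C (hopping \<mu> \<gamma> m n j) (field m n w) =
      - fermion m n (j + 1) (conj_transpose (\<Gamma>_block \<mu> \<gamma> (j + 1)) *v w j) s s'
      - fermion m n j (\<Gamma>_block \<mu> \<gamma> (j + 1) *v w (j + 1)) s s'" if j: "j \<in> {m..<n}" for j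
  proof -
    have "?C (hopping \<mu> \<gamma> m n j) (field m n w) = (\<Sum>l\<in>{m..n}. ?C (hopping \<mu> \<gamma> m n j) (fermion m n l (w l)))"
      unfolding field_def by (rule R)
    \<comment> \<open>Only fermions at the two ends of the bond fail to commute with it.\<close>
    also have "\<dots> = (\<Sum>l\<in>{j, j + 1}. ?C (hopping \<mu> \<gamma> m n j) (fermion m n l (w l)))"
      using j by (intro sum.mono_neutral_right) (auto simp: commutator_hopping_far)
    also have "\<dots> = ?C (hopping \<mu> \<gamma> m n j) (fermion m n j (w j)) + ?C (hopping \<mu> \<gamma> m n j) (fermion m n (j + 1) (w (j + 1)))"
      by simp
    finally show ?thesis
      by (simp only: commutator_hopping_left[OF j] commutator_hopping_right[OF j] fermion_minus) simp
  qed
  have z: "of_real (\<nu> j) * ?C (z_at m n j) (field m n w) = - fermion m n j (J_block \<nu> j *v w j) s s'"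
    if j: "j \<in> {m..n}" for j
  proof -
    have J: "J_block \<nu> j *v x = - (of_real (\<nu> j) *s (\<chi> a. - 2 * spin a * x $ a))" for x
      using exhaust_2 by (auto simp: vec_eq_iff J_block_def matrix_vector_mult_def sum_2 forall_2)
    have "?C (z_at m n j) (field m n w) = (\<Sum>l\<in>{m..n}. ?C (z_at m n j) (fermion m n l (w l)))"
      unfolding field_def by (rule R)
    also have "\<dots> = (\<Sum>l\<in>{m..n}. if j = l then fermion m n j (\<chi> a. - 2 * spin a * w j $ a) s s' else 0)"
      using j by (intro sum.cong) (auto simp: commutator_z_at)
    finally show ?thesis using j by (simp add: J fermion_scale fermion_minus)
  qed
  \<comment> \<open>The summand at m vanishes because the cut sequence is 0 at m - 1; the others are
    shifted by one.\<close>
  have 1: "(\<Sum>j\<in>{m..n}. fermion m n j (conj_transpose (\<Gamma>_block \<mu> \<gamma> j) *v box_cut m n w (j - 1)) s s')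
     = (\<Sum>j\<in>{m..<n}. fermion m n (j + 1) (conj_transpose (\<Gamma>_block \<mu> \<gamma> (j + 1)) *v w j) s s')"
  proof -
    have "(\<Sum>j\<in>{m..n}. fermion m n j (conj_transpose (\<Gamma>_block \<mu> \<gamma> j) *v box_cut m n w (j - 1)) s s')
     = (\<Sum>j\<in>{m + 1..n}. fermion m n j (conj_transpose (\<Gamma>_block \<mu> \<gamma> j) *v box_cut m n w (j - 1)) s s')"
      by (intro sum.mono_neutral_right) (auto simp: box_cut_def fermion_0)
    also have "\<dots> = (\<Sum>j\<in>{m..<n}. fermion m n (j + 1) (conj_transpose (\<Gamma>_block \<mu> \<gamma> (j + 1)) *v w j) s s')"
      by (rule sum.reindex_bij_witness[of _ "\<lambda>j. j + 1" "\<lambda>j. j - 1"]) (auto simp: box_cut_def)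
    finally show ?thesis .
  qed
  \<comment> \<open>The summand at n vanishes because the cut sequence is 0 at n + 1.\<close>
  have 2: "(\<Sum>j\<in>{m..n}. fermion m n j (\<Gamma>_block \<mu> \<gamma> (j + 1) *v box_cut m n w (j + 1)) s s')
     = (\<Sum>j\<in>{m..<n}. fermion m n j (\<Gamma>_block \<mu> \<gamma> (j + 1) *v w (j + 1)) s s')"
    by (intro sum.mono_neutral_cong_right) (auto simp: box_cut_def fermion_0)
  have 3: "(\<Sum>j\<in>{m..n}. fermion m n j (J_block \<nu> j *v box_cut m n w j) s s')
     = (\<Sum>j\<in>{m..n}. fermion m n j (J_block \<nu> j *v w j) s s')"
    by (intro sum.cong) (auto simp: box_cut_def)
  have "?C (hamiltonian \<mu> \<gamma> \<nu> m n) (field m n w) = (\<Sum>j\<in>{m..<n}. ?C (hopping \<mu> \<gamma> m n j) (field m n w))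
     + (\<Sum>j\<in>{m..n}. of_real (\<nu> j) * ?C (z_at m n j) (field m n w))"
    unfolding hamiltonian_eq by (rule L)
  also have "\<dots> = - field m n (jacobi \<mu> \<gamma> \<nu> (box_cut m n w)) s s'"
    by (simp add: hop z field_def jacobi_def fermion_add sum.distrib 1 2 3 sum_negf sum_subtractf)
  finally show ?thesis .
qed

text \<open>Flips at distinct sites give distinct configurations, so a single fermion contributes to
  this entry. Up to a factor of modulus 1 it is a component of \<open>w k\<close>.\<close>

lemma field_flip:
  assumes "k \<in> {m..n}" "s \<in> confs {m..n}"
  shows "field m n w s (flip k s) = string m k s * w k $ other (s k)"
proof -
  have "fermion m n l (w l) s (flip k s) = (if l = k then string m k s * w k $ other (s k) else 0)" for l
  proof -
    have "flip k s = flip l s \<longleftrightarrow> l = k"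
      by (metis flip_simps(1,2) other_simps(4))
    then show ?thesis using assms by (auto simp: fermion_def monomial_def)
  qed
  then show ?thesis using assms by (simp add: field_def)
qed

lemma field_unit: 
  assumes "j \<in> {m..n}"
  shows "field m n (\<lambda>l. if l = j then x else 0) = fermion m n j x"
proof (intro ext)
  fix s s'
  have "field m n (\<lambda>l. if l = j then x else 0) s s' = (\<Sum>l\<in>{m..n}. if l = j then fermion m n j x s s' else 0)"
    unfolding field_def by (intro sum.cong) (auto simp: fermion_0)
  then show "field m n (\<lambda>l. if l = j then x else 0) s s' = fermion m n j x s s'" using assms by simp
qed

section \<open>Norms and supports of the observables\<close>

text \<open>Makes the supremum in \<open>op_norm\<close> meaningful: on the reals it may be compared
  with its members only if the set is bounded above.\<close>

lemma vec_norm_bdd: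
  assumes "finite S"
  obtains K where "\<And>\<psi>. vec_norm S \<psi> \<le> 1 \<Longrightarrow> vec_norm S (op_apply S A \<psi>) \<le> K"
proof -
  have fin: "finite (confs S)" by (rule finite_confs[OF assms])
  have le: "cmod (\<psi> s) \<le> 1" if "vec_norm S \<psi> \<le> 1" "s \<in> confs S" for \<psi> s
    using member_le_L2_set[OF fin that(2), of "\<lambda>s. cmod (\<psi> s)"] that(1) by (simp add: vec_norm_def)
  have "vec_norm S (op_apply S A \<psi>) \<le> (\<Sum>s\<in>confs S. \<Sum>r\<in>confs S. cmod (A s r))" if "vec_norm S \<psi> \<le> 1" for \<psi>
  proof -
    have "vec_norm S (op_apply S A \<psi>) \<le> (\<Sum>s\<in>confs S. cmod (op_apply S A \<psi> s))"
      unfolding vec_norm_def by (rule L2_set_le_sum) simp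
    also have "\<dots> \<le> (\<Sum>s\<in>confs S. \<Sum>r\<in>confs S. cmod (A s r))"
      unfolding op_apply_def
      by (intro sum_mono sum_norm_le) (auto simp: norm_mult intro!: mult_left_le le[OF that])
    finally show ?thesis .
  qed
  then show thesis by (rule that)
qed

lemma entry_le_op_norm:
  assumes "finite S" "s \<in> confs S" "s' \<in> confs S"
  shows "cmod (A s s') \<le> op_norm S A"
proof -
  have fin: "finite (confs S)" by (rule finite_confs[OF assms(1)])
  obtain K where K: "\<And>\<psi>. vec_norm S \<psi> \<le> 1 \<Longrightarrow> vec_norm S (op_apply S A \<psi>) \<le> K"
    using vec_norm_bdd[OF assms(1)] by blast
  define \<psi> :: "configuration \<Rightarrow> complex" where "\<psi> r = (if r = s' then 1 else 0)" for r
  have "vec_norm S \<psi> = 1"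
  proof -
    have "(\<Sum>r\<in>confs S. (cmod (\<psi> r))\<^sup>2) = (\<Sum>r\<in>confs S. if r = s' then 1 else 0)"
      by (intro sum.cong) (auto simp: \<psi>_def)
    then show ?thesis using assms fin by (simp add: vec_norm_def L2_set_def)
  qed
  have "op_apply S A \<psi> s = (\<Sum>r\<in>confs S. if r = s' then A s s' else 0)"
    unfolding op_apply_def by (intro sum.cong) (auto simp: \<psi>_def)
  then have "cmod (A s s') = cmod (op_apply S A \<psi> s)" using assms fin by simp
  also have "\<dots> \<le> vec_norm S (op_apply S A \<psi>)"
    unfolding vec_norm_def by (rule member_le_L2_set) (use assms fin in auto)
  also have "\<dots> \<le> op_norm S A"
    unfolding op_norm_def
    by (rule cSUP_upper) (use \<open>vec_norm S \<psi> = 1\<close> K in \<open>auto intro!: bdd_aboveI2[of _ _ K]\<close>)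
  finally show ?thesis .
qed

text \<open>Up to weights of modulus at most 1 the operator permutes coordinates; injectivity of
  \<open>F\<close> allows the sum of squares to be reindexed.\<close>

lemma op_norm_monomial_le:
  assumes "finite S" "F ` confs S \<subseteq> confs S" "inj_on F (confs S)" "\<And>s. s \<in> confs S \<Longrightarrow> cmod (a s) \<le> 1"
  shows "op_norm S (monomial S F a) \<le> 1"
  unfolding op_norm_def
proof (rule cSUP_least)
  have fin: "finite (confs S)" by (rule finite_confs[OF assms(1)])
  show "{\<psi>. vec_norm S \<psi> \<le> 1} \<noteq> {}"
    by (auto simp: vec_norm_def L2_set_def intro!: exI[of _ "\<lambda>_. 0"])
  fix \<psi> assume "\<psi> \<in> {\<psi>. vec_norm S \<psi> \<le> 1}"
  have ap: "op_apply S (monomial S F a) \<psi> s = a s * \<psi> (F s)" if "s \<in> confs S" for s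
  proof -
    have "op_apply S (monomial S F a) \<psi> s = (\<Sum>r\<in>confs S. if r = F s then a s * \<psi> (F s) else 0)"
      unfolding op_apply_def using that by (intro sum.cong) (auto simp: monomial_def)
    then show ?thesis using that assms fin by auto
  qed
  have "(\<Sum>s\<in>confs S. (cmod (op_apply S (monomial S F a) \<psi> s))\<^sup>2) \<le> (\<Sum>s\<in>confs S. (cmod (\<psi> (F s)))\<^sup>2)"
    using assms(4) by (intro sum_mono power_mono) (auto simp: ap norm_mult intro!: mult_left_le_one_le)
  also have "\<dots> = (\<Sum>s\<in>F ` confs S. (cmod (\<psi> s))\<^sup>2)"
    by (simp add: sum.reindex[OF assms(3)])
  also have "\<dots> \<le> (\<Sum>s\<in>confs S. (cmod (\<psi> s))\<^sup>2)"
    by (rule sum_mono2) (use assms fin in auto)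
  finally have "vec_norm S (op_apply S (monomial S F a) \<psi>) \<le> vec_norm S \<psi>"
    unfolding vec_norm_def L2_set_def by (rule real_sqrt_le_mono)
  then show "vec_norm S (op_apply S (monomial S F a) \<psi>) \<le> 1" using \<open>\<psi> \<in> _\<close> by simp
qed

text \<open>An operator acting trivially at i has nonzero entries only where both configurations
  agree at i, and these do not depend on the common value. A violation forces i into every set on
  which the operator can live.\<close>

lemma embed_not_mem:
  assumes "i \<notin> S" "i \<in> \<Lambda>" "A \<in> embed \<Lambda> S ` local_algebra S" "s \<in> confs \<Lambda>" "s' \<in> confs \<Lambda>" "A s s' \<noteq> 0"
  shows "s i = s' i \<and> A (flip i s) (flip i s') = A s s'"
proof -
  obtain B where B: "A = embed \<Lambda> S B" using assms(3) by auto
  have s: "s i = s' i" using assms B by (auto simp: embed_def split: if_splits)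
  have "flip i s \<in> confs \<Lambda>" "flip i s' \<in> confs \<Lambda>"
    using flip_image_confs[OF assms(2)] assms(4,5) by auto
  moreover have "restrict (flip i t) S = restrict t S" for t
    using assms(1) by (auto simp: flip_def)
  moreover have "(\<forall>j\<in>\<Lambda> - S. flip i s j = flip i s' j) = (\<forall>j\<in>\<Lambda> - S. s j = s' j)"
    using s by (auto simp: flip_def)
  ultimately have "A (flip i s) (flip i s') = A s s'"
    unfolding B embed_def using assms(4,5) by simp
  with s show ?thesis by simp
qed

text \<open>The last hypothesis supplies, for each site of \<open>S\<close>, a witness that no
  carrying set can omit it. This gives the minimality with respect to inclusion.\<close>

lemma supp_eqI:
  assumes "S \<subseteq> \<Lambda>" "A \<in> embed \<Lambda> S ` local_algebra S"
    and "\<And>i. i \<in> S \<Longrightarrow> \<exists>s\<in>confs \<Lambda>. \<exists>s'\<in>confs \<Lambda>. A s s' \<noteq> 0 \<and> (s i \<noteq> s' i \<or> A (flip i s) (flip i s') \<noteq> A s s')"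
  shows "supp \<Lambda> A = S"
  unfolding supp_def
proof (rule Least_equality)
  show "S \<subseteq> \<Lambda> \<and> A \<in> embed \<Lambda> S ` local_algebra S" using assms by simp
  fix S' assume S': "S' \<subseteq> \<Lambda> \<and> A \<in> embed \<Lambda> S' ` local_algebra S'"
  show "S \<subseteq> S'"
  proof (rule ccontr)
    assume "\<not> S \<subseteq> S'"
    then obtain i where i: "i \<in> S" "i \<notin> S'" by auto
    then show False using assms(3)[OF i(1)] embed_not_mem[of i S' \<Lambda> A] S' assms(1) by blast
  qed
qed

lemma const_mem_confs: "restrict (\<lambda>_. a) S \<in> confs S"
  by (simp add: confs_def)

lemma restrict_mem_confs: "s \<in> confs \<Lambda> \<Longrightarrow> S \<subseteq> \<Lambda> \<Longrightarrow> restrict s S \<in> confs S"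
  by (auto simp: confs_def)

lemma supp_z_at:
  assumes "k \<in> {m..n}" shows "supp {m..n} (z_at m n k) = {k}"
proof (rule supp_eqI)
  have eq: "z_at m n k = embed {m..n} {k} (one_site k pauli_z)"
    using at_site_pauli(3)[OF assms] by (simp add: z_at_def at_site_def)
  moreover have "one_site k pauli_z \<in> local_algebra {k}" by (auto simp: one_site_def local_algebra_def)
  ultimately show "z_at m n k \<in> embed {m..n} {k} ` local_algebra {k}" by simp
  fix i assume "i \<in> {k}"
  \<comment> \<open>The diagonal entry at this configuration changes sign under the flip at
    k.\<close>
  let ?s = "restrict (\<lambda>_. 1) {m..n} :: configuration"
  have "?s \<in> confs {m..n}" "flip k ?s \<in> confs {m..n}"
    using flip_image_confs[OF assms] const_mem_confs[of 1 "{m..n}"] by auto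
  then show "\<exists>s\<in>confs {m..n}. \<exists>s'\<in>confs {m..n}. z_at m n k s s' \<noteq> 0 \<and>
     (s i \<noteq> s' i \<or> z_at m n k (flip i s) (flip i s') \<noteq> z_at m n k s s')"
    using \<open>i \<in> {k}\<close> assms by (intro bexI[of _ ?s]) (auto simp: z_at_def monomial_def)
qed (use assms in auto)

text \<open>The string reaches down to the left end m: for i < j a flip at i reverses the sign of
  the entry. At i = j the row and column configurations differ.\<close>

lemma supp_fermion:
  assumes j: "j \<in> {m..n}" and x: "x \<noteq> 0"
  shows "supp {m..n} (fermion m n j x) = {m..j}"
proof (rule supp_eqI)
  show "{m..j} \<subseteq> {m..n}" using j by auto
  have "fermion m n j x = embed {m..n} {m..j} (fermion m j j x)"
  proof (intro ext)
    fix s s'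
    have mem: "flip j s \<in> confs {m..n}" if "s \<in> confs {m..n}"
      using flip_image_confs[OF j] that by auto
    have agree: "(\<forall>i\<in>{m..n} - {m..j}. s i = s' i) \<and> restrict s' {m..j} = flip j (restrict s {m..j}) \<longleftrightarrow> s' = flip j s"
      if "s \<in> confs {m..n}" "s' \<in> confs {m..n}"
    proof -
      have "restrict s' {m..j} = flip j (restrict s {m..j}) \<longleftrightarrow> (\<forall>i\<in>{m..j} - {j}. s i = s' i) \<and> s' j \<noteq> s j"
        using eq_flip_iff[of "restrict s {m..j}" "{m..j}" "restrict s' {m..j}" j] j that
        by (simp add: restrict_mem_confs)
      moreover have "(\<forall>i\<in>{m..n} - {j}. s i = s' i) \<longleftrightarrow>
          (\<forall>i\<in>{m..n} - {m..j}. s i = s' i) \<and> (\<forall>i\<in>{m..j} - {j}. s i = s' i)"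
        using j by auto
      ultimately show ?thesis using j that eq_flip_iff[of s "{m..n}" s' j] by blast
    qed
    have "string m j (restrict s {m..j}) = string m j s"
      unfolding string_def by (intro prod.cong) auto
    moreover have "restrict s {m..j} j = s j" using j by simp
    moreover have "restrict s {m..j} \<in> confs {m..j}" if "s \<in> confs {m..n}"
      using restrict_mem_confs[OF that, of "{m..j}"] j by simp
    ultimately show "fermion m n j x s s' = embed {m..n} {m..j} (fermion m j j x) s s'"
      using mem agree unfolding embed_def fermion_def monomial_def
      by (smt (verit))
  qed
  moreover have "fermion m j j x \<in> local_algebra {m..j}"
    using j by (intro fermion_local_algebra) auto
  ultimately show "fermion m n j x \<in> embed {m..n} {m..j} ` local_algebra {m..j}" by simp
  fix i assume i: "i \<in> {m..j}"
  obtain a where a: "x $ a \<noteq> 0" using x by (auto simp: vec_eq_iff)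
  \<comment> \<open>The value \<open>other a\<close> at j selects the nonzero coefficient
    \<open>x $ a\<close>.\<close>
  let ?s = "restrict (\<lambda>_. other a) {m..n} :: configuration"
  have mem: "?s \<in> confs {m..n}" "flip i t \<in> confs {m..n}" "flip j t \<in> confs {m..n}"
    if "t \<in> confs {m..n}" for t
    using flip_image_confs[of i "{m..n}"] flip_image_confs[of j "{m..n}"] const_mem_confs[of "other a" "{m..n}"] i j that
    by auto
  have s: "?s \<in> confs {m..n}" by (rule const_mem_confs)
  define X where "X = string m j ?s * x $ a"
  have "string m j ?s \<noteq> 0"
    using norm_string[of m j ?s] by (metis norm_zero zero_neq_one)
  then have X: "X \<noteq> 0" using a by (simp add: X_def)
  have f: "fermion m n j x ?s (flip j ?s) = X"
    using s j by (simp add: fermion_def monomial_def X_def)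
  have "?s i \<noteq> flip j ?s i \<or> fermion m n j x (flip i ?s) (flip i (flip j ?s)) \<noteq> X"
  proof (cases "i = j")
    case False
    then have neg: "fermion m n j x (flip i ?s) (flip i (flip j ?s)) = - X"
      using i j mem(2)[OF s] unfolding flip_commute[of i j]
      by (simp add: fermion_def monomial_def X_def del: restrict_apply) (simp add: i j)
    have "- X \<noteq> X" using X by simp
    then show ?thesis unfolding neg by (rule disjI2)
  qed (metis flip_simps(1) other_simps(4))
  then show "\<exists>s\<in>confs {m..n}. \<exists>s'\<in>confs {m..n}. fermion m n j x s s' \<noteq> 0 \<and>
     (s i \<noteq> s' i \<or> fermion m n j x (flip i s) (flip i s') \<noteq> fermion m n j x s s')"
    using X f
    by (intro bexI[where x = ?s, OF _ s] bexI[where x = "flip j ?s", OF _ mem(3)[OF s]]) (simp only: not_False_eq_True simp_thms)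
qed

subsection \<open>Exponentials of skew-symmetric operators\<close>

lemma bounded_linear_power_bound:
  fixes T :: "'a :: real_normed_vector \<Rightarrow> 'a"
  assumes "\<And>x. norm (T x) \<le> K * norm x" "K \<ge> 0"
  shows "norm ((T ^^ n) u) \<le> K ^ n * norm u"
proof (induction n)
  case (Suc n)
  have "norm ((T ^^ Suc n) u) \<le> K * norm ((T ^^ n) u)" using assms by simp
  also have "\<dots> \<le> K * (K ^ n * norm u)" using Suc assms(2) by (rule mult_left_mono)
  finally show ?case by (simp add: mult_ac)
qed simp

text \<open>Termwise comparison with the real exponential series. The bound on the partial sums is
  uniform in \<open>N\<close>, as the error estimate for truncated exponentials requires.\<close>

lemma
  fixes T :: "'a :: real_normed_vector \<Rightarrow> 'a"
  assumes "\<And>x. norm (T x) \<le> K * norm x" "K \<ge> 0"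
  shows summable_norm_exp_series: "summable (\<lambda>n. norm ((t ^ n / fact n) *\<^sub>R (T ^^ n) u))"
    and exp_series_partial_le: "norm (\<Sum>n<N. (t ^ n / fact n) *\<^sub>R (T ^^ n) u) \<le> exp (\<bar>t\<bar> * K) * norm u"
proof -
  have le: "norm ((t ^ n / fact n) *\<^sub>R (T ^^ n) u) \<le> (inverse (fact n) * (\<bar>t\<bar> * K) ^ n) * norm u" for n
  proof -
    have "norm ((t ^ n / fact n) *\<^sub>R (T ^^ n) u) = \<bar>t\<bar> ^ n / fact n * norm ((T ^^ n) u)"
      by (simp add: power_abs)
    also have "\<dots> \<le> \<bar>t\<bar> ^ n / fact n * (K ^ n * norm u)"
      by (intro mult_left_mono bounded_linear_power_bound assms) simp
    finally show ?thesis by (simp add: power_mult_distrib divide_inverse mult_ac)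
  qed
  have sm: "summable (\<lambda>n. (inverse (fact n) * (\<bar>t\<bar> * K) ^ n) * norm u)"
    by (intro summable_mult2 summable_exp)
  show "summable (\<lambda>n. norm ((t ^ n / fact n) *\<^sub>R (T ^^ n) u))"
    by (rule summable_comparison_test'[OF sm]) (use le in simp)
  have "norm (\<Sum>n<N. (t ^ n / fact n) *\<^sub>R (T ^^ n) u) \<le> (\<Sum>n<N. (inverse (fact n) * (\<bar>t\<bar> * K) ^ n) * norm u)"
    by (intro sum_norm_le le)
  also have "\<dots> \<le> (\<Sum>n. (inverse (fact n) * (\<bar>t\<bar> * K) ^ n) * norm u)"
    using assms(2) by (intro sum_le_suminf sm) auto
  also have "\<dots> = exp (\<bar>t\<bar> * K) * norm u"
    by (subst suminf_mult2[symmetric]) (auto simp: exp_def summable_exp scaleR_conv_of_real)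
  finally show "norm (\<Sum>n<N. (t ^ n / fact n) *\<^sub>R (T ^^ n) u) \<le> exp (\<bar>t\<bar> * K) * norm u" .
qed

text \<open>The partial sums \<open>A\<^sub>N\<close> satisfy \<open>A\<^sub>N\<^sub>+\<^sub>1' = T A\<^sub>N\<close>, so the derivative of \<open>\<parallel>A\<^sub>N\<^sub>+\<^sub>1\<parallel>\<^sup>2\<close> only sees
  the last term of the sum and tends to 0.\<close>

lemma norm_exp_skew:
  fixes T :: "'a :: {real_inner, banach} \<Rightarrow> 'a"
  assumes "bounded_linear T" and skew: "\<And>x. T x \<bullet> x = 0"
  shows "norm (\<Sum>n. (t ^ n / fact n) *\<^sub>R (T ^^ n) u) = norm u"
proof -
  obtain K where K: "\<And>x. norm (T x) \<le> K * norm x" "K \<ge> 0"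
    using bounded_linear.nonneg_bounded[OF assms(1)] by (metis mult.commute)
  interpret T: bounded_linear T by fact
  define A where "A N s = (\<Sum>n<N. (s ^ n / fact n) *\<^sub>R (T ^^ n) u)" for N and s :: real
  have A0: "A (Suc N) 0 = u" for N
    unfolding A_def by (subst sum.lessThan_Suc_shift) simp
  have dA: "(A (Suc N) has_vector_derivative T (A N s)) (at s)" for N s
  proof (induction N)
    case 0
    then show ?case by (simp add: A_def T.zero)
  next
    case (Suc N)
    have "((\<lambda>s. s ^ Suc N / fact (Suc N)) has_real_derivative s ^ N / fact N) (at s)"
    proof -
      have "real (Suc N) * s ^ N / fact (Suc N) = s ^ N / fact N"
        by (simp add: fact_Suc del: of_nat_Suc)
      then show ?thesis
        using DERIV_cdivide[OF DERIV_pow[of "Suc N" s UNIV], of "fact (Suc N)"]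
        by (simp del: fact_Suc power_Suc of_nat_Suc)
    qed
    then have "((\<lambda>s. (s ^ Suc N / fact (Suc N)) *\<^sub>R (T ^^ Suc N) u) has_vector_derivative
        (s ^ N / fact N) *\<^sub>R (T ^^ Suc N) u) (at s)"
      by (intro derivative_eq_intros) (auto simp: has_real_derivative_iff_has_vector_derivative)
    from has_vector_derivative_add[OF Suc this] show ?case
      by (simp add: A_def T.add T.scaleR del: power_Suc fact_Suc cong: sum.cong)
  qed
  \<comment> \<open>A bound for the derivative of the squared norm of \<open>A (Suc N)\<close> on
    |s| <= |t|: the first factor estimates the last term of the sum, the second one
    \<open>T (A N s)\<close>. The factorial sends it to 0.\<close>
  define \<epsilon> where "\<epsilon> N = 2 * ((\<bar>t\<bar> * K) ^ N / fact N * norm u) * (K * (exp (\<bar>t\<bar> * K) * norm u))" for N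
  have bound: "\<bar>(norm (A (Suc N) t))\<^sup>2 - (norm u)\<^sup>2\<bar> \<le> \<epsilon> N * \<bar>t\<bar>" for N
  proof -
    define \<phi> where "\<phi> s = A (Suc N) s \<bullet> A (Suc N) s" for s
    have d\<phi>: "(\<phi> has_real_derivative 2 * (A (Suc N) s \<bullet> T (A N s))) (at s)" for s
    proof -
      have "(\<phi> has_derivative (\<lambda>h. A (Suc N) s \<bullet> (h *\<^sub>R T (A N s)) + (h *\<^sub>R T (A N s)) \<bullet> A (Suc N) s)) (at s)"
        unfolding \<phi>_def using dA[of N s] unfolding has_vector_derivative_def
        by (intro has_derivative_inner)
      then show ?thesis
        by (simp add: has_field_derivative_def inner_commute algebra_simps cong: if_cong)
           (simp add: mult.commute[of _ "2 * _"])
    qed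
    have le: "\<bar>2 * (A (Suc N) s \<bullet> T (A N s))\<bar> \<le> \<epsilon> N" if "\<bar>s\<bar> \<le> \<bar>t\<bar>" for s
    proof -
      have "A (Suc N) s \<bullet> T (A N s) = ((s ^ N / fact N) *\<^sub>R (T ^^ N) u) \<bullet> T (A N s)"
        using skew[of "A N s"] by (simp add: A_def inner_add_left inner_add_right inner_commute)
      also have "\<bar>\<dots>\<bar> \<le> norm ((s ^ N / fact N) *\<^sub>R (T ^^ N) u) * norm (T (A N s))"
        by (rule Cauchy_Schwarz_ineq2)
      also have "\<dots> \<le> ((\<bar>t\<bar> * K) ^ N / fact N * norm u) * (K * (exp (\<bar>t\<bar> * K) * norm u))"
      proof (rule mult_mono)
        have "norm ((s ^ N / fact N) *\<^sub>R (T ^^ N) u) \<le> \<bar>s\<bar> ^ N / fact N * (K ^ N * norm u)"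
          using bounded_linear_power_bound[OF K, of N u] by (simp add: power_abs divide_right_mono mult_left_mono)
        also have "\<dots> \<le> \<bar>t\<bar> ^ N / fact N * (K ^ N * norm u)"
          using that K by (intro mult_right_mono divide_right_mono power_mono) auto
        finally show "norm ((s ^ N / fact N) *\<^sub>R (T ^^ N) u) \<le> (\<bar>t\<bar> * K) ^ N / fact N * norm u"
          by (simp add: power_mult_distrib mult_ac)
        have "norm (T (A N s)) \<le> K * norm (A N s)" by (rule K)
        also have "\<dots> \<le> K * (exp (\<bar>s\<bar> * K) * norm u)"
          unfolding A_def by (intro mult_left_mono exp_series_partial_le K)
        also have "\<dots> \<le> K * (exp (\<bar>t\<bar> * K) * norm u)"
          using that K by (intro mult_left_mono mult_right_mono) (auto intro: mult_right_mono)
        finally show "norm (T (A N s)) \<le> K * (exp (\<bar>t\<bar> * K) * norm u)" .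
      qed (use K in auto)
      finally show ?thesis by (simp add: \<epsilon>_def abs_mult)
    qed
    \<comment> \<open>Mean value inequality on a ball around 0, which covers both signs of
      t.\<close>
    have "\<bar>\<phi> t - \<phi> 0\<bar> \<le> \<epsilon> N * \<bar>t - 0\<bar>"
      unfolding real_norm_def[symmetric]
      by (rule field_differentiable_bound[of "cball 0 \<bar>t\<bar>" \<phi> "\<lambda>s. 2 * (A (Suc N) s \<bullet> T (A N s))"])
         (use d\<phi> le in \<open>auto intro: DERIV_subset simp: dist_norm\<close>)
    then show ?thesis by (simp add: \<phi>_def A0 power2_norm_eq_inner)
  qed
  have "\<epsilon> \<longlonglongrightarrow> 2 * (0 * norm u) * (K * (exp (\<bar>t\<bar> * K) * norm u))"
    unfolding \<epsilon>_def
    using summable_LIMSEQ_zero[OF summable_exp[of "\<bar>t\<bar> * K"]]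
    by (intro tendsto_intros) (simp add: divide_inverse mult.commute)
  then have "(\<lambda>N. \<epsilon> N * \<bar>t\<bar>) \<longlonglongrightarrow> 0"
    by (simp add: tendsto_mult_left_zero)
  then have "(\<lambda>N. (norm (A (Suc N) t))\<^sup>2 - (norm u)\<^sup>2) \<longlonglongrightarrow> 0"
    by (rule Lim_null_comparison[rotated]) (use bound in auto)
  moreover have "(\<lambda>N. A N t) \<longlonglongrightarrow> (\<Sum>n. (t ^ n / fact n) *\<^sub>R (T ^^ n) u)"
    unfolding A_def
    by (rule summable_LIMSEQ[OF summable_norm_cancel[OF summable_norm_exp_series[OF K]]])
  then have "(\<lambda>N. (norm (A (Suc N) t))\<^sup>2 - (norm u)\<^sup>2) \<longlonglongrightarrow>
      (norm (\<Sum>n. (t ^ n / fact n) *\<^sub>R (T ^^ n) u))\<^sup>2 - (norm u)\<^sup>2"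
    by (intro tendsto_intros LIMSEQ_Suc)
  ultimately have "(norm (\<Sum>n. (t ^ n / fact n) *\<^sub>R (T ^^ n) u))\<^sup>2 - (norm u)\<^sup>2 = 0"
    using LIMSEQ_unique by blast
  then show ?thesis by (simp add: power2_eq_iff_nonneg)
qed

section \<open>From the Lieb-Robinson bound to matrix entries in finite volume\<close>

lemma commutator_scale_right:
  "commutator S A (\<lambda>s s'. c * B s s') s s' = c * commutator S A B s s'"
  unfolding commutator_def op_mult_def
  by (simp add: sum_distrib_left right_diff_distrib mult_ac)

text \<open>Each commutator with the Hamiltonian applies the cut-off Jacobi matrix once and
  contributes a sign; the recursion for the coefficients supplies the factorial.\<close>

lemma dyson_coeff_field:
  "dyson_coeff {m..n} (hamiltonian \<mu> \<gamma> \<nu> m n) (field m n w) N s s'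
    = (- 1) ^ N / fact N * field m n (((\<lambda>w. jacobi \<mu> \<gamma> \<nu> (box_cut m n w)) ^^ N) w) s s'"
proof (induction N arbitrary: s s')
  case 0
  have "field m n w \<in> local_algebra {m..n}"
    using fermion_local_algebra unfolding field_def local_algebra_def by (auto intro!: sum.neutral)
  then show ?case by (simp add: dyson_coeff_0)
next
  case (Suc N)
  let ?w = "((\<lambda>w. jacobi \<mu> \<gamma> \<nu> (box_cut m n w)) ^^ N) w" and ?H = "hamiltonian \<mu> \<gamma> \<nu> m n"
  have "of_nat (Suc N) * dyson_coeff {m..n} ?H (field m n w) (Suc N) s s'
      = commutator {m..n} ?H (\<lambda>s s'. (- 1) ^ N / fact N * field m n ?w s s') s s'"
    unfolding commutator_dyson_coeff[OF finite_atLeastAtMost_int hamiltonian_local_algebra, symmetric]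
    by (intro arg_cong[where f = "\<lambda>X. commutator {m..n} ?H X s s'"] ext Suc)
  also have "\<dots> = (- 1) ^ Suc N / fact N * field m n (jacobi \<mu> \<gamma> \<nu> (box_cut m n ?w)) s s'"
    unfolding commutator_scale_right commutator_hamiltonian_field by simp
  finally show ?case by (simp add: divide_simps mult_ac del: of_nat_Suc)
qed

text \<open>The sign (-1)^N turns (it)^N into (-it)^N, so the coefficients of a field evolve by
  e^{-itM} with the cut-off matrix M.\<close>

lemma evolve_field_sums:
  assumes "s \<in> confs {m..n}"
  shows "(\<lambda>N. (- \<i> * of_real t) ^ N / fact N * field m n (((\<lambda>w. jacobi \<mu> \<gamma> \<nu> (box_cut m n w)) ^^ N) w) s s')
    sums evolve \<mu> \<gamma> \<nu> m n t (field m n w) s s'"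
proof -
  have "(\<i> * of_real t) ^ N * dyson_coeff {m..n} (hamiltonian \<mu> \<gamma> \<nu> m n) (field m n w) N s s'
     = (- \<i> * of_real t) ^ N / fact N * field m n (((\<lambda>w. jacobi \<mu> \<gamma> \<nu> (box_cut m n w)) ^^ N) w) s s'" for N
    unfolding dyson_coeff_field using power_minus[of "\<i> * of_real t" N] by simp
  moreover have "(\<lambda>N. (\<i> * of_real t) ^ N * dyson_coeff {m..n} (hamiltonian \<mu> \<gamma> \<nu> m n) (field m n w) N s s')
    sums evolve \<mu> \<gamma> \<nu> m n t (field m n w) s s'"
    using heisenberg_sums[OF finite_atLeastAtMost_int hamiltonian_local_algebra assms, of "\<i> * of_real t"]
    by (simp add: evolve_def Let_def)
  ultimately show ?thesis by simp
qed

text \<open>The bound is tested on a fermion at j and sigma^z_k, both of norm at most 1, whose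
  supports [m, j] and {k} have distance k - j. One entry of their commutator has twice the modulus
  of the matrix entry in question.\<close>

lemma chain_propagation_bound:
  assumes LR: "\<And>A B. (A, B) \<in> D_pairs {m..n} \<Longrightarrow>
      op_norm {m..n} (commutator {m..n} (evolve \<mu> \<gamma> \<nu> m n t A) B)
        \<le> C * op_norm {m..n} A * op_norm {m..n} B *
          exp (- \<eta> * (of_int (site_dist (supp {m..n} A) (supp {m..n} B)) - v * \<bar>t\<bar>))"
    and "C > 0" and jk: "j < k" "j \<in> {m..n}" "k \<in> {m..n}"
  shows "cmod (\<Sum>N. (- \<i> * of_real t) ^ N / fact N *
      ((\<lambda>w. jacobi \<mu> \<gamma> \<nu> (box_cut m n w)) ^^ N) (\<lambda>l. if l = j then axis \<beta> 1 else 0) k $ \<alpha>)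
    \<le> C * exp (- \<eta> * (of_int (k - j) - v * \<bar>t\<bar>))"
proof -
  define e :: "int \<Rightarrow> complex ^ 2" where "e = (\<lambda>l. if l = j then axis \<beta> 1 else 0)"
  define f where "f N = (- \<i> * of_real t) ^ N / fact N * ((\<lambda>w. jacobi \<mu> \<gamma> \<nu> (box_cut m n w)) ^^ N) e k $ \<alpha>" for N
  \<comment> \<open>As \<open>other\<close> is an involution, the entry from \<open>s\<close> to
    \<open>flip k s\<close> picks out the component \<alpha> at k.\<close>
  define s :: configuration where "s = restrict (\<lambda>_. other \<alpha>) {m..n}"
  let ?A = "fermion m n j (axis \<beta> 1)" and ?B = "z_at m n k"
  let ?E = "exp (- \<eta> * (of_int (k - j) - v * \<bar>t\<bar>))"
  have s: "s \<in> confs {m..n}" "flip k s \<in> confs {m..n}" "s k = other \<alpha>"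
    using flip_image_confs[OF jk(3)] const_mem_confs[of "other \<alpha>" "{m..n}"] jk by (auto simp: s_def)
  have A: "?A = field m n e" using field_unit[OF jk(2)] by (simp add: e_def)
  have supp: "supp {m..n} ?A = {m..j}" "supp {m..n} ?B = {k}"
    using jk by (auto simp: supp_fermion supp_z_at axis_eq_0_iff)
  have dist: "site_dist {m..j} {k} = k - j"
    unfolding site_dist_def using jk by (intro Min_eqI) (auto intro!: image_eqI[of _ _ "(j, k)"])
  have D: "(?A, ?B) \<in> D_pairs {m..n}"
    unfolding D_pairs_def using jk supp by (auto simp: fermion_local_algebra z_at_local_algebra)
  have nA: "op_norm {m..n} ?A \<le> 1"
    unfolding fermion_def
  proof (rule op_norm_monomial_le)
    show "inj_on (flip j) (confs {m..n})" by (metis inj_onI flip_simps(3))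
    show "cmod (string m j s * axis \<beta> 1 $ other (s j)) \<le> 1" for s
      by (simp add: norm_mult axis_def)
  qed (use jk flip_image_confs in auto)
  have nB: "op_norm {m..n} ?B \<le> 1"
    unfolding z_at_def by (rule op_norm_monomial_le) auto
  have nonneg: "0 \<le> op_norm {m..n} X" for X
    using entry_le_op_norm[of "{m..n}" s s X] s(1) norm_ge_zero order_trans by blast
  have f: "(\<lambda>N. string m k s * f N) sums evolve \<mu> \<gamma> \<nu> m n t ?A s (flip k s)"
    using evolve_field_sums[OF s(1), of t \<mu> \<gamma> \<nu> e "flip k s"]
    by (simp add: A f_def field_flip[OF jk(3) s(1)] s(3) mult_ac)
  then have "evolve \<mu> \<gamma> \<nu> m n t ?A s (flip k s) = (\<Sum>N. string m k s * f N)"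
    by (rule sums_unique)
  \<comment> \<open>Convergence is inherited from the series with the constant nonzero factor
    \<open>string m k s\<close>.\<close>
  moreover have "summable f"
  proof -
    have "string m k s \<noteq> 0" using norm_string[of m k s] by (metis norm_zero zero_neq_one)
    with sums_summable[OF f] show ?thesis by (rule summable_mult_D)
  qed
  ultimately have ev: "cmod (evolve \<mu> \<gamma> \<nu> m n t ?A s (flip k s)) = cmod (\<Sum>N. f N)"
    by (simp add: suminf_mult norm_mult)
  have "cmod (spin (flip k s k) - spin (s k)) = 2"
    using exhaust_2[of \<alpha>] by (auto simp: s)
  then have "cmod (commutator {m..n} (evolve \<mu> \<gamma> \<nu> m n t ?A) ?B s (flip k s)) = 2 * cmod (\<Sum>N. f N)"
    unfolding commutator_right_z_at[OF jk(3) s(1,2)] norm_mult ev by simp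
  then have "2 * cmod (\<Sum>N. f N) \<le> op_norm {m..n} (commutator {m..n} (evolve \<mu> \<gamma> \<nu> m n t ?A) ?B)"
    using entry_le_op_norm[OF _ s(1,2)] by (metis finite_atLeastAtMost_int)
  also have "\<dots> \<le> C * op_norm {m..n} ?A * op_norm {m..n} ?B * ?E"
    using LR[OF D] by (simp add: supp dist)
  also have "\<dots> \<le> C * 1 * 1 * ?E"
    using nA nB nonneg \<open>C > 0\<close> by (intro mult_mono mult_nonneg_nonneg) auto
  \<comment> \<open>The factor 2 on the left is given away.\<close>
  finally have "cmod (\<Sum>N. f N) \<le> C * ?E"
    using norm_ge_zero[of "\<Sum>N. f N"] by linarith
  then show ?thesis by (simp add: f_def e_def)
qed

instance l2 :: banach ..

subsection \<open>The block Jacobi operator\<close>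

lemma scaleR_vec_complex: "r *\<^sub>R x = complex_of_real r *s x"
  by (rule vec_eq_iff[THEN iffD2]) (simp add: scaleR_conv_of_real[where 'a = complex])

lemma scaleC_of_real: "of_real r *\<^sub>C u = r *\<^sub>R u"
  by transfer (simp add: scaleR_vec_complex)

lemma scaleC_scaleC: "c *\<^sub>C d *\<^sub>C u = (c * d) *\<^sub>C u"
  by transfer (simp add: fun_eq_iff vector_smult_assoc)

lemma scaleC_one: "1 *\<^sub>C u = u"
  by transfer simp

lemma norm_scaleC: "norm (c *\<^sub>C u) = cmod c * norm u"
  by (simp add: norm_l2_eq scaleC.rep_eq norm_vector_scalar_mult power_mult_distrib
      infsum_cmult_right' real_sqrt_mult)

text \<open>Makes iM skew for the real inner product once M is symmetric and complex linear; this is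
  the source of the isometry of e^{itM}.\<close>

lemma inner_scaleC_i: "(\<i> *\<^sub>C u) \<bullet> w = - (u \<bullet> (\<i> *\<^sub>C w))"
proof -
  have "(\<i> *s x) \<bullet> y = - (x \<bullet> (\<i> *s y))" for x y :: "complex ^ 2"
    by (simp add: inner_vec_def inner_complex_def sum_2)
  then show ?thesis by (simp add: inner_l2_def scaleC.rep_eq infsum_uminus)
qed

lemma scaleC_add: "c *\<^sub>C (u + w) = c *\<^sub>C u + c *\<^sub>C w"
  by transfer (simp add: fun_eq_iff vec_eq_iff distrib_left)

lemma scaleC_scaleR: "c *\<^sub>C r *\<^sub>R u = r *\<^sub>R c *\<^sub>C u"
  by transfer (simp add: fun_eq_iff vec_eq_iff)

lemma l2_eqI: "(\<And>j. seq_of u j = seq_of w j) \<Longrightarrow> u = w"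
  by (simp add: seq_of_inject[symmetric] fun_eq_iff)

lemma bounded_linear_seq_of: "bounded_linear (\<lambda>u. seq_of u k $ a)"
proof (rule bounded_linear_intro[of _ 1])
  show "norm (seq_of u k $ a) \<le> norm u * 1" for u
    using norm_seq_of_le[of u k] Finite_Cartesian_Product.norm_nth_le[of "seq_of u k" a] by simp
qed (simp_all add: plus_l2.rep_eq scaleR_l2.rep_eq)

lemma seq_of_M_inf_jacobi:
  assumes "periodic \<mu>" "periodic \<gamma>" "periodic \<nu>"
  shows "seq_of (M_inf \<mu> \<gamma> \<nu> u) = jacobi \<mu> \<gamma> \<nu> (seq_of u)"
  by (intro ext) (simp add: seq_of_M_inf[OF assms] jacobi_def)

lemma periodic_bounded:
  fixes f :: "int \<Rightarrow> real"
  assumes "periodic f"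
  obtains b where "\<And>j. \<bar>f j\<bar> \<le> b" "b \<ge> 0"
proof -
  define b where "b = Max (range (\<lambda>j. \<bar>f j\<bar>))"
  have "finite (range (\<lambda>j. \<bar>f j\<bar>))"
    using finite_imageI[OF periodic_finite_range[OF assms], of abs] by (simp add: image_image)
  then have "\<bar>f j\<bar> \<le> b" for j by (simp add: b_def)
  with that show thesis by (metis abs_ge_zero order_trans)
qed

lemma blocks_bounded:
  assumes "periodic \<mu>" "periodic \<gamma>" "periodic \<nu>"
  obtains K where "K \<ge> 0"
    "\<And>j x. norm (conj_transpose (\<Gamma>_block \<mu> \<gamma> j) *v x) \<le> K * norm x"
    "\<And>j x. norm (J_block \<nu> j *v x) \<le> K * norm x"
    "\<And>j x. norm (\<Gamma>_block \<mu> \<gamma> j *v x) \<le> K * norm x"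
proof -
  obtain a where a: "\<And>j. \<bar>\<mu> j\<bar> \<le> a" "a \<ge> 0" using periodic_bounded[OF assms(1)] by blast
  obtain b where b: "\<And>j. \<bar>\<gamma> j\<bar> \<le> b" "b \<ge> 0" using periodic_bounded[OF assms(2)] by blast
  obtain c where c: "\<And>j. \<bar>\<nu> j\<bar> \<le> c" "c \<ge> 0" using periodic_bounded[OF assms(3)] by blast
  \<comment> \<open>The moduli of the entries of a \<Gamma> block sum to 4|\<mu>| + 4|\<mu>
    \<gamma>|, those of a J block to 4|\<nu>|; one constant serves all blocks.\<close>
  define K where "K = 4 * a + 4 * (a * b) + 4 * c"
  have ab: "\<bar>\<gamma> j\<bar> * \<bar>\<mu> j\<bar> \<le> a * b" "\<bar>\<mu> j\<bar> * \<bar>\<gamma> j\<bar> \<le> a * b" for j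
    using mult_mono[OF a(1) b(1) a(2), of j j] by (simp_all add: mult.commute)
  have bound: "norm (A *v x) \<le> K * norm x" if "(\<Sum>i\<in>UNIV. \<Sum>k\<in>UNIV. cmod (A $ i $ k)) \<le> K"
    for A :: "complex ^ 2 ^ 2" and x
    using norm_mat_vec_le[of A x] mult_right_mono[OF that, of "norm x"] by simp
  show thesis
  proof (rule that[of K])
    show "K \<ge> 0" using a b c by (simp add: K_def)
    fix j x
    show "norm (conj_transpose (\<Gamma>_block \<mu> \<gamma> j) *v x) \<le> K * norm x"
      using a(1)[of "j - 1"] ab[of "j - 1"] c(2)
      by (intro bound) (simp add: sum_2 \<Gamma>_block_def conj_transpose_def norm_mult K_def)
    show "norm (J_block \<nu> j *v x) \<le> K * norm x"
    proof (rule bound)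
      have "4 * \<bar>\<nu> j\<bar> \<le> K"
        unfolding K_def using a(2) c(1)[of j] mult_nonneg_nonneg[OF a(2) b(2)] by linarith
      then show "(\<Sum>i\<in>UNIV. \<Sum>k\<in>UNIV. cmod (J_block \<nu> j $ i $ k)) \<le> K"
        by (simp add: sum_2 J_block_def norm_mult)
    qed
    show "norm (\<Gamma>_block \<mu> \<gamma> j *v x) \<le> K * norm x"
      using a(1)[of "j - 1"] ab[of "j - 1"] c(2)
      by (intro bound) (simp add: sum_2 \<Gamma>_block_def norm_mult K_def)
  qed
qed

lemma inner_conj_transpose:
  fixes A :: "complex ^ 2 ^ 2"
  shows "(A *v x) \<bullet> y = x \<bullet> (conj_transpose A *v y)"
  by (simp add: inner_vec_def inner_complex_def matrix_vector_mult_def conj_transpose_def sum_2 algebra_simps)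

lemma conj_transpose_conj_transpose: "conj_transpose (conj_transpose A) = A"
  by (simp add: conj_transpose_def vec_eq_iff)

lemma conj_transpose_J_block: "conj_transpose (J_block \<nu> j) = J_block \<nu> j"
  by (simp add: conj_transpose_def J_block_def vec_eq_iff forall_2)

lemma jacobi_linear:
  "jacobi \<mu> \<gamma> \<nu> (\<lambda>j. u j + w j) = (\<lambda>j. jacobi \<mu> \<gamma> \<nu> u j + jacobi \<mu> \<gamma> \<nu> w j)"
  "jacobi \<mu> \<gamma> \<nu> (\<lambda>j. c *s u j) = (\<lambda>j. c *s jacobi \<mu> \<gamma> \<nu> u j)"
  by (auto simp: jacobi_def fun_eq_iff matrix_vector_right_distrib vector_scalar_commute vector_add_ldistrib)

lemma l2_summable_shift: "(\<lambda>j. (norm (seq_of u (j + k)))\<^sup>2) summable_on UNIV" 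
  using summable_on_reindex_bij_betw[of "\<lambda>j. j + k" UNIV UNIV "\<lambda>j. (norm (seq_of u j))\<^sup>2"]
    l2_summable_sq[of u] by (simp add: bij_plus_right)

lemma l2_infsum_shift: "(\<Sum>\<^sub>\<infinity>j. (norm (seq_of u (j + k)))\<^sup>2) = (norm u)\<^sup>2"
  using infsum_reindex_bij_betw[of "\<lambda>j. j + k" UNIV UNIV "\<lambda>j. (norm (seq_of u j))\<^sup>2"]
  by (simp add: bij_plus_right norm_l2_eq infsum_nonneg)

text \<open>Row j involves three neighbouring sites; with (a + b + c)^2 <= 3 (a^2 + b^2 + c^2) and
  the invariance of the norm under shifts the constant becomes 3K.\<close>

lemma norm_M_inf_bounded:
  assumes "periodic \<mu>" "periodic \<gamma>" "periodic \<nu>"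
  obtains K where "\<And>u. norm (M_inf \<mu> \<gamma> \<nu> u) \<le> K * norm u" "K \<ge> 0"
proof -
  obtain K where K: "K \<ge> 0"
    "\<And>j x. norm (conj_transpose (\<Gamma>_block \<mu> \<gamma> j) *v x) \<le> K * norm x"
    "\<And>j x. norm (J_block \<nu> j *v x) \<le> K * norm x"
    "\<And>j x. norm (\<Gamma>_block \<mu> \<gamma> j *v x) \<le> K * norm x"
    using blocks_bounded[OF assms] by blast
  have "norm (M_inf \<mu> \<gamma> \<nu> u) \<le> 3 * K * norm u" for u
  proof -
    let ?n = "\<lambda>j. norm (seq_of u j)"
    have "(norm (seq_of (M_inf \<mu> \<gamma> \<nu> u) j))\<^sup>2 \<le> 3 * K\<^sup>2 * ((?n (j + - 1))\<^sup>2 + (?n j)\<^sup>2 + (?n (j + 1))\<^sup>2)" for j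
    proof -
      have "norm (seq_of (M_inf \<mu> \<gamma> \<nu> u) j) \<le> K * ?n (j + - 1) + K * ?n j + K * ?n (j + 1)"
        unfolding seq_of_M_inf[OF assms]
        by (intro order_trans[OF norm_triangle_ineq] add_mono) (use K in auto)
      then have "(norm (seq_of (M_inf \<mu> \<gamma> \<nu> u) j))\<^sup>2 \<le> (K * ?n (j + - 1) + K * ?n j + K * ?n (j + 1))\<^sup>2"
        by (intro power_mono) auto
      also have "\<dots> = K\<^sup>2 * (?n (j + - 1) + ?n j + ?n (j + 1))\<^sup>2"
        by (simp add: power2_eq_square algebra_simps)
      also have "\<dots> \<le> K\<^sup>2 * (3 * ((?n (j + - 1))\<^sup>2 + (?n j)\<^sup>2 + (?n (j + 1))\<^sup>2))"
      proof (intro mult_left_mono)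
        have "3 * (a\<^sup>2 + b\<^sup>2 + c\<^sup>2) - (a + b + c)\<^sup>2 = (a - b)\<^sup>2 + (b - c)\<^sup>2 + (a - c)\<^sup>2" for a b c :: real
          by (simp add: power2_eq_square algebra_simps)
        then show "(?n (j + - 1) + ?n j + ?n (j + 1))\<^sup>2 \<le> 3 * ((?n (j + - 1))\<^sup>2 + (?n j)\<^sup>2 + (?n (j + 1))\<^sup>2)"
          by (metis diff_ge_0_iff_ge sum_power2_ge_zero add_nonneg_nonneg zero_le_power2)
      qed simp
      finally show ?thesis by (simp add: algebra_simps)
    qed
    then have "(norm (M_inf \<mu> \<gamma> \<nu> u))\<^sup>2 \<le> (\<Sum>\<^sub>\<infinity>j. 3 * K\<^sup>2 * ((?n (j + - 1))\<^sup>2 + (?n j)\<^sup>2 + (?n (j + 1))\<^sup>2))"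
      using l2_infsum_shift[of "M_inf \<mu> \<gamma> \<nu> u" 0] l2_summable_shift[of u "- 1"] l2_summable_shift[of u 1]
      by (subst l2_infsum_shift[of _ 0, symmetric], intro infsum_mono)
         (auto intro!: summable_on_cmult_right summable_on_add l2_summable_sq simp del: diff_add_eq)
    also have "\<dots> = 3 * K\<^sup>2 * ((norm u)\<^sup>2 + (norm u)\<^sup>2 + (norm u)\<^sup>2)"
      using l2_infsum_shift[of u "- 1"] l2_infsum_shift[of u 1] l2_infsum_shift[of u 0]
        l2_summable_shift[of u "- 1"] l2_summable_shift[of u 1]
      by (simp add: infsum_cmult_right' infsum_add summable_on_add l2_summable_sq)
    also have "\<dots> = (3 * K * norm u)\<^sup>2" by (simp add: power2_eq_square)
    finally show ?thesis using K(1) by (simp add: power2_le_iff_abs_le)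
  qed
  with that[of "3 * K"] K(1) show thesis by simp
qed

lemma
  assumes "periodic \<mu>" "periodic \<gamma>" "periodic \<nu>"
  shows bounded_linear_M_inf: "bounded_linear (M_inf \<mu> \<gamma> \<nu>)"
    and M_inf_scaleC: "M_inf \<mu> \<gamma> \<nu> (c *\<^sub>C u) = c *\<^sub>C M_inf \<mu> \<gamma> \<nu> u"
proof -
  obtain K where K: "\<And>u. norm (M_inf \<mu> \<gamma> \<nu> u) \<le> K * norm u"
    using norm_M_inf_bounded[OF assms] by blast
  show "bounded_linear (M_inf \<mu> \<gamma> \<nu>)"
    by (rule bounded_linear_intro[where K = K])
      (auto intro!: l2_eqI simp: seq_of_M_inf_jacobi[OF assms] plus_l2.rep_eq scaleR_l2.rep_eq scaleR_vec_complex
        jacobi_linear K mult.commute)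
  show "M_inf \<mu> \<gamma> \<nu> (c *\<^sub>C u) = c *\<^sub>C M_inf \<mu> \<gamma> \<nu> u"
    by (rule l2_eqI) (simp add: seq_of_M_inf_jacobi[OF assms] scaleC.rep_eq jacobi_linear)
qed

text \<open>After moving the blocks across the inner product, the upper off-diagonal part of one
  side is the lower part of the other, shifted by one site. Absolute summability permits splitting
  and shifting the sums.\<close>

lemma M_inf_symmetric:
  assumes "periodic \<mu>" "periodic \<gamma>" "periodic \<nu>"
  shows "M_inf \<mu> \<gamma> \<nu> u \<bullet> w = u \<bullet> M_inf \<mu> \<gamma> \<nu> w"
proof -
  obtain K where K: "K \<ge> 0"
    "\<And>j x. norm (conj_transpose (\<Gamma>_block \<mu> \<gamma> j) *v x) \<le> K * norm x"
    "\<And>j x. norm (J_block \<nu> j *v x) \<le> K * norm x"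
    "\<And>j x. norm (\<Gamma>_block \<mu> \<gamma> j *v x) \<le> K * norm x"
    using blocks_bounded[OF assms] by blast
  \<comment> \<open>Couples \<open>u\<close> at j to \<open>w\<close> at j + 1 across the bond
    between them.\<close>
  define f where "f u w j = seq_of u j \<bullet> (\<Gamma>_block \<mu> \<gamma> (j + 1) *v seq_of w (j + 1))" for u w j
  define g where "g j = seq_of u j \<bullet> (J_block \<nu> j *v seq_of w j)" for j
  have pr: "(\<lambda>j. norm (seq_of u j) * (K * norm (seq_of w (j + k)))) summable_on UNIV" for u w k
  proof (rule summable_on_comparison_test)
    show "(\<lambda>j. K * ((norm (seq_of u j))\<^sup>2 + (norm (seq_of w (j + k)))\<^sup>2)) summable_on UNIV"
      by (intro summable_on_add summable_on_cmult_right l2_summable_sq l2_summable_shift)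
    have "a * (K * b) \<le> K * (a\<^sup>2 + b\<^sup>2)" if "a \<ge> 0" "b \<ge> 0" for a b
    proof -
      have "0 \<le> a * b" using that by simp
      then have "a * b \<le> a\<^sup>2 + b\<^sup>2" using sum_squares_bound[of a b] by linarith
      then show ?thesis using K(1) mult_left_mono[of "a * b" "a\<^sup>2 + b\<^sup>2" K] by (simp add: mult_ac)
    qed
    then show "norm (seq_of u j) * (K * norm (seq_of w (j + k)))
        \<le> K * ((norm (seq_of u j))\<^sup>2 + (norm (seq_of w (j + k)))\<^sup>2)" for j
      by simp
  qed (use K(1) in auto)
  have f: "f u w summable_on UNIV" for u w
  proof (rule abs_summable_summable, rule summable_on_comparison_test[OF pr[of u w 1]])
    show "norm (f u w j) \<le> norm (seq_of u j) * (K * norm (seq_of w (j + 1)))" for j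
      unfolding f_def real_norm_def
      by (rule order_trans[OF Cauchy_Schwarz_ineq2]) (intro mult_left_mono K norm_ge_zero)
  qed simp
  have g: "g summable_on UNIV"
  proof (rule abs_summable_summable, rule summable_on_comparison_test[OF pr[of u w 0]])
    show "norm (g j) \<le> norm (seq_of u j) * (K * norm (seq_of w (j + 0)))" for j
      unfolding g_def real_norm_def add_0_right
      by (rule order_trans[OF Cauchy_Schwarz_ineq2]) (intro mult_left_mono K norm_ge_zero)
  qed simp
  have sh: "(\<lambda>j. f u w (j + - 1)) summable_on UNIV" "(\<Sum>\<^sub>\<infinity>j. f u w (j + - 1)) = (\<Sum>\<^sub>\<infinity>j. f u w j)" for u w
    using summable_on_reindex_bij_betw[of "\<lambda>j. j + - 1" UNIV UNIV "f u w"] f[of u w]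
      infsum_reindex_bij_betw[of "\<lambda>j. j + - 1" UNIV UNIV "f u w"] bij_plus_right[of "- 1 :: int"] by auto
  have "seq_of (M_inf \<mu> \<gamma> \<nu> u) j \<bullet> seq_of w j = f u w (j + - 1) + g j + f w u j" for j
    unfolding seq_of_M_inf[OF assms] f_def g_def inner_add_left
    by (simp add: inner_conj_transpose conj_transpose_conj_transpose conj_transpose_J_block)
       (simp add: inner_conj_transpose[symmetric] inner_commute)
  then have 1: "M_inf \<mu> \<gamma> \<nu> u \<bullet> w = (\<Sum>\<^sub>\<infinity>j. f u w j) + (\<Sum>\<^sub>\<infinity>j. g j) + (\<Sum>\<^sub>\<infinity>j. f w u j)"
    unfolding inner_l2_def by (simp only: infsum_add summable_on_add f g sh)
  have "seq_of u j \<bullet> seq_of (M_inf \<mu> \<gamma> \<nu> w) j = f w u (j + - 1) + g j + f u w j" for j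
    unfolding seq_of_M_inf[OF assms] f_def g_def inner_add_right
    by (simp add: inner_conj_transpose[symmetric] inner_commute)

  then have 2: "u \<bullet> M_inf \<mu> \<gamma> \<nu> w = (\<Sum>\<^sub>\<infinity>j. f w u j) + (\<Sum>\<^sub>\<infinity>j. g j) + (\<Sum>\<^sub>\<infinity>j. f u w j)"
    unfolding inner_l2_def by (simp only: infsum_add summable_on_add f g sh)
  from 1 2 show ?thesis by simp
qed

section \<open>The unitary group generated by the block Jacobi operator\<close>

text \<open>With T = iM the exponential of an imaginary multiple of M becomes a real power series in
  a skew operator, to which \<open>norm_exp_skew\<close> applies.\<close>

lemma
  assumes "periodic \<mu>" "periodic \<gamma>" "periodic \<nu>"
  defines "T \<equiv> \<lambda>u. \<i> *\<^sub>C M_inf \<mu> \<gamma> \<nu> u"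
  shows exp_op_M_inf_eq: "exp_op (\<i> * of_real t) (M_inf \<mu> \<gamma> \<nu>) u = (\<Sum>n. (t ^ n / fact n) *\<^sub>R (T ^^ n) u)"
    and summable_exp_M_inf: "summable (\<lambda>n. (t ^ n / fact n) *\<^sub>R (T ^^ n) u)"
    and norm_exp_op_M_inf: "norm (exp_op (\<i> * of_real t) (M_inf \<mu> \<gamma> \<nu>) u) = norm u"
    and seq_of_i_M_inf_power: "seq_of ((T ^^ n) u) = (\<lambda>k. \<i> ^ n *s (jacobi \<mu> \<gamma> \<nu> ^^ n) (seq_of u) k)"
proof -
  let ?M = "M_inf \<mu> \<gamma> \<nu>"
  interpret M: bounded_linear ?M by (rule bounded_linear_M_inf[OF assms(1-3)])
  have pow: "(T ^^ n) u = \<i> ^ n *\<^sub>C (?M ^^ n) u" for n u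
    by (induction n) (simp_all add: T_def M_inf_scaleC[OF assms(1-3)] scaleC_scaleC scaleC_one)
  have powM: "seq_of ((?M ^^ n) u) = (jacobi \<mu> \<gamma> \<nu> ^^ n) (seq_of u)" for n u
    by (induction n) (simp_all add: seq_of_M_inf_jacobi[OF assms(1-3)])
  show "seq_of ((T ^^ n) u) = (\<lambda>k. \<i> ^ n *s (jacobi \<mu> \<gamma> \<nu> ^^ n) (seq_of u) k)"
    by (simp add: pow scaleC.rep_eq powM)
  have "((\<i> * of_real t) ^ n / fact n) *\<^sub>C (?M ^^ n) u = (t ^ n / fact n) *\<^sub>R (T ^^ n) u" for n
    by (simp add: pow scaleC_of_real[symmetric] scaleC_scaleC power_mult_distrib mult.commute)
  then show eq: "exp_op (\<i> * of_real t) ?M u = (\<Sum>n. (t ^ n / fact n) *\<^sub>R (T ^^ n) u)"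
    by (simp add: exp_op_def)
  obtain K where K: "\<And>u. norm (?M u) \<le> K * norm u" "K \<ge> 0"
    using norm_M_inf_bounded[OF assms(1-3)] by blast
  have TK: "norm (T u) \<le> K * norm u" for u
    using K by (simp add: T_def norm_scaleC)
  show "summable (\<lambda>n. (t ^ n / fact n) *\<^sub>R (T ^^ n) u)"
    by (rule summable_norm_cancel[OF summable_norm_exp_series[OF TK K(2)]])
  have "bounded_linear T"
    by (rule bounded_linear_intro[where K = K])
      (auto simp: T_def M.add M.scaleR scaleC_add scaleC_scaleR norm_scaleC K mult.commute)
  moreover have "T x \<bullet> x = 0" for x
  proof -
    have "T x \<bullet> x = ?M (\<i> *\<^sub>C x) \<bullet> x" by (simp add: T_def M_inf_scaleC[OF assms(1-3)])
    also have "\<dots> = (\<i> *\<^sub>C x) \<bullet> ?M x" by (rule M_inf_symmetric[OF assms(1-3)])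
    also have "\<dots> = - (T x \<bullet> x)" by (simp add: inner_scaleC_i T_def inner_commute)
    finally show ?thesis by simp
  qed
  ultimately show "norm (exp_op (\<i> * of_real t) ?M u) = norm u"
    unfolding eq by (rule norm_exp_skew)
qed

text \<open>Components are bounded functionals, so the series can be evaluated entrywise. It then
  has the form of the finite-volume series with the uncut matrix in place of the cut one.\<close>

lemma exp_op_M_inf_component:
  assumes "periodic \<mu>" "periodic \<gamma>" "periodic \<nu>"
  shows "(\<lambda>n. (- \<i> * of_real t) ^ n / fact n * (jacobi \<mu> \<gamma> \<nu> ^^ n) (seq_of u) k $ a)
    sums (seq_of (exp_op (- \<i> * of_real t) (M_inf \<mu> \<gamma> \<nu>) u) k $ a)"
proof -
  define T where "T = (\<lambda>u. \<i> *\<^sub>C M_inf \<mu> \<gamma> \<nu> u)"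
  have "(\<lambda>n. seq_of (((- t) ^ n / fact n) *\<^sub>R (T ^^ n) u) k $ a)
      sums (seq_of (\<Sum>n. ((- t) ^ n / fact n) *\<^sub>R (T ^^ n) u) k $ a)"
    unfolding T_def
    by (rule bounded_linear.sums[OF bounded_linear_seq_of summable_sums[OF summable_exp_M_inf[OF assms]]])
  moreover have "seq_of (((- t) ^ n / fact n) *\<^sub>R (T ^^ n) u) k $ a
     = (- \<i> * of_real t) ^ n / fact n * (jacobi \<mu> \<gamma> \<nu> ^^ n) (seq_of u) k $ a" for n
  proof -
    have "(- \<i> * of_real t) ^ n = of_real ((- t) ^ n) * \<i> ^ n"
      by (simp add: power_mult_distrib[symmetric] mult.commute)
    then show ?thesis
      unfolding T_def scaleR_l2.rep_eq seq_of_i_M_inf_power[OF assms]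
      by (simp add: scaleR_conv_of_real[where 'a = complex])
  qed
  moreover have "(\<Sum>n. ((- t) ^ n / fact n) *\<^sub>R (T ^^ n) u) = exp_op (- \<i> * of_real t) (M_inf \<mu> \<gamma> \<nu>) u"
    using exp_op_M_inf_eq[OF assms, of "- t" u] by (simp add: T_def)
  ultimately show ?thesis by simp
qed

lemma norm_exp_op_M_inf_neg:
  assumes "periodic \<mu>" "periodic \<gamma>" "periodic \<nu>"
  shows "norm (exp_op (- \<i> * of_real t) (M_inf \<mu> \<gamma> \<nu>) u) = norm u"
  using norm_exp_op_M_inf[OF assms, of "- t" u] by simp

definition unit_seq :: "int \<Rightarrow> 2 \<Rightarrow> int \<Rightarrow> complex ^ 2"
  where "unit_seq j b = (\<lambda>l. if l = j then axis b 1 else 0)"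

lemma l2_finite_support:
  fixes w :: "int \<Rightarrow> complex ^ 2"
  assumes "finite F" "\<And>l. l \<notin> F \<Longrightarrow> w l = 0"
  shows "seq_of (Abs_l2 w) = w"
proof (rule Abs_l2_inverse, rule CollectI)
  have "(\<lambda>l. (norm (w l))\<^sup>2) summable_on F" using assms(1) by simp
  then show "(\<lambda>l. (norm (w l))\<^sup>2) summable_on UNIV"
    by (rule summable_on_cong_neutral[THEN iffD1, rotated -1]) (auto simp: assms)
qed

lemma inner_unit:
  assumes "seq_of e = unit_seq k a"
  shows "u \<bullet> (c *\<^sub>C e) = (seq_of u k $ a) \<bullet> c"
proof -
  have ax: "c *s axis a 1 = (axis a c :: complex ^ 2)" by (simp add: vec_eq_iff axis_def)
  have "u \<bullet> (c *\<^sub>C e) = (\<Sum>\<^sub>\<infinity>j\<in>{k}. seq_of u j \<bullet> seq_of (c *\<^sub>C e) j)"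
    unfolding inner_l2_def by (rule infsum_cong_neutral) (auto simp: scaleC.rep_eq assms unit_seq_def)
  also have "\<dots> = (seq_of u k $ a) \<bullet> c"
    by (simp add: scaleC.rep_eq assms unit_seq_def ax inner_axis)
  finally show ?thesis .
qed

text \<open>Powers of M are Hermitian. In terms of the real inner product, the real part of an entry
  is obtained by testing with a unit vector and the imaginary part by testing with i times that
  vector.\<close>

lemma jacobi_power_conj_sym:
  assumes "periodic \<mu>" "periodic \<gamma>" "periodic \<nu>"
  shows "(jacobi \<mu> \<gamma> \<nu> ^^ n) (unit_seq j b) k $ a = cnj ((jacobi \<mu> \<gamma> \<nu> ^^ n) (unit_seq k a) j $ b)"
proof -
  let ?M = "M_inf \<mu> \<gamma> \<nu>"
  define e where "e j b = Abs_l2 (unit_seq j b)" for j b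
  have e: "seq_of (e j b) = unit_seq j b" for j b
    unfolding e_def by (rule l2_finite_support[of "{j}"]) (auto simp: unit_seq_def)
  have powM: "seq_of ((?M ^^ n) u) = (jacobi \<mu> \<gamma> \<nu> ^^ n) (seq_of u)" for u
    by (induction n) (simp_all add: seq_of_M_inf_jacobi[OF assms])
  have sym: "(?M ^^ n) u \<bullet> w = u \<bullet> (?M ^^ n) w" for u w
    by (induction n arbitrary: u w) (simp_all add: M_inf_symmetric[OF assms] funpow_swap1)
  have powC: "(?M ^^ n) (c *\<^sub>C u) = c *\<^sub>C (?M ^^ n) u" for c u
    by (induction n) (simp_all add: M_inf_scaleC[OF assms])
  have "((?M ^^ n) (e j b)) \<bullet> (1 *\<^sub>C e k a) = (?M ^^ n) (e k a) \<bullet> (1 *\<^sub>C e j b)"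
    unfolding scaleC_one by (metis sym inner_commute)
  then have 1: "Re (seq_of ((?M ^^ n) (e j b)) k $ a) = Re (seq_of ((?M ^^ n) (e k a)) j $ b)"
    by (simp add: inner_unit[OF e] inner_complex_def)
  have "((?M ^^ n) (e j b)) \<bullet> (\<i> *\<^sub>C e k a) = e j b \<bullet> (\<i> *\<^sub>C (?M ^^ n) (e k a))"
    by (simp only: sym powC)
  also have "\<dots> = (\<i> *\<^sub>C (?M ^^ n) (e k a)) \<bullet> e j b"
    by (rule inner_commute)
  also have "\<dots> = - ((?M ^^ n) (e k a) \<bullet> (\<i> *\<^sub>C e j b))"
    by (rule inner_scaleC_i)
  finally have 2: "Im (seq_of ((?M ^^ n) (e j b)) k $ a) = - Im (seq_of ((?M ^^ n) (e k a)) j $ b)"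
    by (simp add: inner_unit[OF e] inner_complex_def)
  from 1 2 show ?thesis by (simp add: powM e complex_eq_iff)
qed

subsection \<open>The infinite-volume limit\<close>

text \<open>Stated for the sup norm, which no box cut increases; the resulting bounds on powers are
  uniform in the box.\<close>

lemma norm_jacobi_bounded:
  assumes "periodic \<mu>" "periodic \<gamma>" "periodic \<nu>"
  obtains K where "K \<ge> 0" "\<And>w c j. (\<And>l. norm (w l) \<le> c) \<Longrightarrow> norm (jacobi \<mu> \<gamma> \<nu> w j) \<le> K * c"
proof -
  obtain K where K: "K \<ge> 0"
    "\<And>j x. norm (conj_transpose (\<Gamma>_block \<mu> \<gamma> j) *v x) \<le> K * norm x"
    "\<And>j x. norm (J_block \<nu> j *v x) \<le> K * norm x"
    "\<And>j x. norm (\<Gamma>_block \<mu> \<gamma> j *v x) \<le> K * norm x"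
    using blocks_bounded[OF assms] by blast
  have "norm (jacobi \<mu> \<gamma> \<nu> w j) \<le> 3 * K * c" if w: "\<And>l. norm (w l) \<le> c" for w c j
  proof -
    have "norm (jacobi \<mu> \<gamma> \<nu> w j) \<le> K * c + K * c + K * c"
      unfolding jacobi_def
      by (intro norm_triangle_le add_mono order_trans[OF K(2)] order_trans[OF K(3)] order_trans[OF K(4)]
          mult_left_mono w K(1))
    then show ?thesis by simp
  qed
  with that[of "3 * K"] K(1) show thesis by simp
qed

lemma norm_box_cut_le: "norm (box_cut m n w l) \<le> norm (w l)"
  by (simp add: box_cut_def)

lemma jacobi_eq_0: "w (j - 1) = 0 \<Longrightarrow> w j = 0 \<Longrightarrow> w (j + 1) = 0 \<Longrightarrow> jacobi \<mu> \<gamma> \<nu> w j = 0"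
  by (simp add: jacobi_def)

lemma jacobi_power_support:
  "\<bar>l - j\<bar> > int n \<Longrightarrow> (jacobi \<mu> \<gamma> \<nu> ^^ n) (unit_seq j b) l = 0"
proof (induction n arbitrary: l)
  case 0
  then show ?case by (auto simp: unit_seq_def)
next
  case (Suc n)
  have "(jacobi \<mu> \<gamma> \<nu> ^^ n) (unit_seq j b) i = 0" if "i \<in> {l - 1, l, l + 1}" for i
    using Suc.prems that by (intro Suc.IH) auto
  then show ?case by (simp add: jacobi_eq_0)
qed

text \<open>Each application spreads the support by at most one site, so the cut goes unnoticed
  until the boundary of the box is passed.\<close>

lemma jacobi_box_cut_power:
  assumes "int n + \<bar>j\<bar> \<le> L"
  shows "((\<lambda>w. jacobi \<mu> \<gamma> \<nu> (box_cut (- L) L w)) ^^ n) (unit_seq j b) = (jacobi \<mu> \<gamma> \<nu> ^^ n) (unit_seq j b)"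
  using assms
proof (induction n)
  case (Suc n)
  let ?w = "(jacobi \<mu> \<gamma> \<nu> ^^ n) (unit_seq j b)"
  have "box_cut (- L) L ?w = ?w"
  proof
    fix l
    show "box_cut (- L) L ?w l = ?w l"
    proof (cases "l \<in> {- L..L}")
      case False
      then have "\<bar>l - j\<bar> > int n" using Suc.prems by auto
      then show ?thesis by (simp add: box_cut_def jacobi_power_support)
    qed (simp add: box_cut_def)
  qed
  with Suc show ?case by simp
qed simp

text \<open>The entry of e^{-itM} from component \<open>b\<close> at site j to component
  \<open>a\<close> at site k.\<close>

definition propagator ::
    "(int \<Rightarrow> real) \<Rightarrow> (int \<Rightarrow> real) \<Rightarrow> (int \<Rightarrow> real) \<Rightarrow> real \<Rightarrow> int \<Rightarrow> 2 \<Rightarrow> int \<Rightarrow> 2 \<Rightarrow> complex"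
  where "propagator \<mu> \<gamma> \<nu> t k a j b =
    (\<Sum>n. (- \<i> * of_real t) ^ n / fact n * (jacobi \<mu> \<gamma> \<nu> ^^ n) (unit_seq j b) k $ a)"

text \<open>Tannery's theorem: every term of the series is eventually constant in L, and the terms
  are dominated by (|t| K)^n / n! uniformly in L.\<close>

lemma propagator_tendsto:
  assumes "periodic \<mu>" "periodic \<gamma>" "periodic \<nu>"
  shows "(\<lambda>L. \<Sum>n. (- \<i> * of_real t) ^ n / fact n *
      ((\<lambda>w. jacobi \<mu> \<gamma> \<nu> (box_cut (- int L) (int L) w)) ^^ n) (unit_seq j b) k $ a)
    \<longlonglongrightarrow> propagator \<mu> \<gamma> \<nu> t k a j b"
proof -
  obtain K where K: "K \<ge> 0" "\<And>w c j. (\<And>l. norm (w l) \<le> c) \<Longrightarrow> norm (jacobi \<mu> \<gamma> \<nu> w j) \<le> K * c"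
    using norm_jacobi_bounded[OF assms] by blast
  define f where "f n L = (- \<i> * of_real t) ^ n / fact n *
      ((\<lambda>w. jacobi \<mu> \<gamma> \<nu> (box_cut (- int L) (int L) w)) ^^ n) (unit_seq j b) k $ a" for n L
  define g where "g n = (- \<i> * of_real t) ^ n / fact n * (jacobi \<mu> \<gamma> \<nu> ^^ n) (unit_seq j b) k $ a" for n
  have pow: "norm (((\<lambda>w. jacobi \<mu> \<gamma> \<nu> (box_cut (- int L) (int L) w)) ^^ n) (unit_seq j b) l) \<le> K ^ n" for L n l
  proof (induction n arbitrary: l)
    case (Suc n)
    have "norm (box_cut (- int L) (int L) (((\<lambda>w. jacobi \<mu> \<gamma> \<nu> (box_cut (- int L) (int L) w)) ^^ n)
       (unit_seq j b)) l) \<le> K ^ n" for l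
      by (rule order_trans, rule norm_box_cut_le, rule Suc)
    then show ?case using K(2) by simp
  qed (simp add: unit_seq_def)
  have "(f n \<longlongrightarrow> g n) sequentially" for n
  proof (rule tendsto_eventually)
    show "\<forall>\<^sub>F L in sequentially. f n L = g n"
      using eventually_ge_at_top[of "n + nat \<bar>j\<bar>"]
    proof eventually_elim
      case (elim L)
      then have "int n + \<bar>j\<bar> \<le> int L" by linarith
      then show ?case by (simp add: f_def g_def jacobi_box_cut_power)
    qed
  qed
  moreover have "norm (f n L) \<le> inverse (fact n) * (\<bar>t\<bar> * K) ^ n" for n L
  proof -
    have "norm (f n L) = \<bar>t\<bar> ^ n / fact n * cmod (((\<lambda>w. jacobi \<mu> \<gamma> \<nu> (box_cut (- int L) (int L) w)) ^^ n) (unit_seq j b) k $ a)"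
      by (simp add: f_def norm_mult norm_divide norm_power)
    also have "\<dots> \<le> \<bar>t\<bar> ^ n / fact n * K ^ n"
      by (intro mult_left_mono order_trans[OF Finite_Cartesian_Product.norm_nth_le pow]) simp
    finally show ?thesis by (simp add: power_mult_distrib divide_inverse mult_ac)
  qed
  then have "\<forall>\<^sub>F (n, L) in sequentially \<times>\<^sub>F sequentially. norm (f n L) \<le> inverse (fact n) * (\<bar>t\<bar> * K) ^ n"
    by (intro always_eventually) auto
  ultimately have "(\<lambda>L. \<Sum>n. f n L) \<longlonglongrightarrow> suminf g"
    using tannerys_theorem[of f g sequentially] summable_exp[of "\<bar>t\<bar> * K"] by simp
  then show ?thesis by (simp add: f_def g_def[abs_def] propagator_def)
qed

text \<open>The adjoint of e^{-itM} is e^{itM}. This exchanges propagation to the right with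
  propagation to the left.\<close>

lemma propagator_conj_sym:
  assumes "periodic \<mu>" "periodic \<gamma>" "periodic \<nu>"
  shows "propagator \<mu> \<gamma> \<nu> t k a j b = cnj (propagator \<mu> \<gamma> \<nu> (- t) j b k a)"
proof -
  define e where "e = Abs_l2 (unit_seq k a)"
  have e: "seq_of e = unit_seq k a"
    unfolding e_def by (rule l2_finite_support[of "{k}"]) (auto simp: unit_seq_def)
  have "summable (\<lambda>n. (- \<i> * of_real (- t)) ^ n / fact n * (jacobi \<mu> \<gamma> \<nu> ^^ n) (unit_seq k a) j $ b)"
    using sums_summable[OF exp_op_M_inf_component[OF assms, of "- t" e j b]] by (simp add: e)
  from bounded_linear.suminf[OF bounded_linear_cnj this]
  show ?thesis unfolding propagator_def jacobi_power_conj_sym[OF assms, of _ j b k a] by simp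
qed

text \<open>Since the strings extend to the left, the commutator argument covers only k > j. The
  conjugation symmetry yields k < j, as the bound depends on |t| alone.\<close>

lemma propagator_bound:
  fixes C \<eta> v :: real
  assumes per: "periodic \<mu>" "periodic \<gamma>" "periodic \<nu>" and "C > 0"
    and LR: "\<And>m n A B t. m \<le> n \<Longrightarrow> card {m..n} \<ge> n0 \<Longrightarrow> (A, B) \<in> D_pairs {m..n} \<Longrightarrow>
      op_norm {m..n} (commutator {m..n} (evolve \<mu> \<gamma> \<nu> m n t A) B)
        \<le> C * op_norm {m..n} A * op_norm {m..n} B *
          exp (- \<eta> * (of_int (site_dist (supp {m..n} A) (supp {m..n} B)) - v * \<bar>t\<bar>))"
    and "j \<noteq> k"
  shows "cmod (propagator \<mu> \<gamma> \<nu> t k a j b) \<le> C * exp (- \<eta> * (of_int \<bar>k - j\<bar> - v * \<bar>t\<bar>))"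
proof -
  have right: "cmod (propagator \<mu> \<gamma> \<nu> t k a j b) \<le> C * exp (- \<eta> * (of_int (k - j) - v * \<bar>t\<bar>))"
    if "j < k" for t j k a b
  proof (rule tendsto_upperbound[OF tendsto_norm[OF propagator_tendsto[OF per]]])
    show "\<forall>\<^sub>F L in sequentially. norm (\<Sum>n. (- \<i> * of_real t) ^ n / fact n *
      ((\<lambda>w. jacobi \<mu> \<gamma> \<nu> (box_cut (- int L) (int L) w)) ^^ n) (unit_seq j b) k $ a)
        \<le> C * exp (- \<eta> * (of_int (k - j) - v * \<bar>t\<bar>))"
      \<comment> \<open>The box [-L, L] must contain both sites and have at least \<open>n0\<close>
        of them.\<close>
      using eventually_ge_at_top[of "nat \<bar>j\<bar> + nat \<bar>k\<bar> + n0"]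
    proof eventually_elim
      case (elim L)
      then have "j \<in> {- int L..int L}" "k \<in> {- int L..int L}" "- int L \<le> int L" "card {- int L..int L} \<ge> n0"
        by auto
      then show ?case
        unfolding unit_seq_def using chain_propagation_bound[OF LR \<open>C > 0\<close> that] by blast
    qed
  qed simp
  show ?thesis
  proof (cases "j < k")
    case False
    then have "k < j" "\<bar>k - j\<bar> = j - k" using \<open>j \<noteq> k\<close> by auto
    then show ?thesis
      using right[of k j "- t" b a] propagator_conj_sym[OF per, of t k a j b] by simp
  qed (use right[of j k t a b] in \<open>simp add: abs_if\<close>)
qed

subsection \<open>Ballistic bound on the position operator\<close>

lemma jacobi_power_sum:
  assumes "finite I"
  shows "(jacobi \<mu> \<gamma> \<nu> ^^ n) (\<lambda>l. \<Sum>i\<in>I. c i *s w i l) = (\<lambda>l. \<Sum>i\<in>I. c i *s (jacobi \<mu> \<gamma> \<nu> ^^ n) (w i) l)"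
proof (induction n)
  case (Suc n)
  have "jacobi \<mu> \<gamma> \<nu> (\<lambda>l. \<Sum>i\<in>I. c i *s w i l) = (\<lambda>l. \<Sum>i\<in>I. c i *s jacobi \<mu> \<gamma> \<nu> (w i) l)" for w
    using assms
  proof (induction I rule: finite_induct)
    case empty
    then show ?case by (simp add: jacobi_def fun_eq_iff)
  next
    case (insert i I)
    then show ?case by (simp add: jacobi_linear)
  qed
  with Suc show ?case by simp
qed simp

text \<open>A finitely supported vector is a finite combination of unit vectors, so the sum over
  sources can be exchanged with the exponential series.\<close>

lemma exp_op_M_inf_propagator:
  assumes per: "periodic \<mu>" "periodic \<gamma>" "periodic \<nu>"
    and F: "finite F" "\<And>l. l \<notin> F \<Longrightarrow> seq_of u l = 0"
  shows "seq_of (exp_op (- \<i> * of_real t) (M_inf \<mu> \<gamma> \<nu>) u) k $ a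
    = (\<Sum>(j, b)\<in>F \<times> UNIV. seq_of u j $ b * propagator \<mu> \<gamma> \<nu> t k a j b)"
proof -
  have expand: "seq_of u l = (\<Sum>(j, b)\<in>F \<times> UNIV. (seq_of u j $ b) *s unit_seq j b l)" for l
  proof -
    have "(\<Sum>(j, b)\<in>F \<times> UNIV. (seq_of u j $ b) *s unit_seq j b l)
      = (\<Sum>j\<in>F. if j = l then (\<Sum>b\<in>UNIV. (seq_of u l $ b) *s axis b 1) else 0)"
      unfolding sum.cartesian_product[symmetric]
      by (intro sum.cong refl) (auto simp: unit_seq_def)
    also have "(\<Sum>b\<in>UNIV. (seq_of u l $ b) *s axis b 1) = seq_of u l"
      by (rule basis_expansion)
    finally show ?thesis using F by auto
  qed
  have u: "(\<lambda>l. \<Sum>i\<in>F \<times> UNIV. (seq_of u (fst i) $ snd i) *s unit_seq (fst i) (snd i) l) = seq_of u"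
    by (rule ext, rule expand[unfolded case_prod_unfold, symmetric])
  have pow: "(jacobi \<mu> \<gamma> \<nu> ^^ n) (seq_of u) k $ a
      = (\<Sum>i\<in>F \<times> UNIV. seq_of u (fst i) $ snd i * (jacobi \<mu> \<gamma> \<nu> ^^ n) (unit_seq (fst i) (snd i)) k $ a)" for n
  proof -
    have "finite (F \<times> (UNIV :: 2 set))" using F(1) by simp
    from jacobi_power_sum[OF this, where c = "\<lambda>i. seq_of u (fst i) $ snd i"
        and w = "\<lambda>i. unit_seq (fst i) (snd i)"]
    show ?thesis unfolding u by simp
  qed
  have sm: "(\<lambda>n. (- \<i> * of_real t) ^ n / fact n * (jacobi \<mu> \<gamma> \<nu> ^^ n) (unit_seq j b) k $ a)
      sums propagator \<mu> \<gamma> \<nu> t k a j b" for j b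
  proof -
    define e where "e = Abs_l2 (unit_seq j b)"
    have e: "seq_of e = unit_seq j b"
      unfolding e_def by (rule l2_finite_support[of "{j}"]) (auto simp: unit_seq_def)
    show ?thesis
      unfolding propagator_def
      using sums_summable[OF exp_op_M_inf_component[OF per, of t e k a]] by (simp add: e summable_sums)
  qed
  have "(\<lambda>n. \<Sum>i\<in>F \<times> UNIV. seq_of u (fst i) $ snd i *
      ((- \<i> * of_real t) ^ n / fact n * (jacobi \<mu> \<gamma> \<nu> ^^ n) (unit_seq (fst i) (snd i)) k $ a))
    sums (\<Sum>i\<in>F \<times> UNIV. seq_of u (fst i) $ snd i * propagator \<mu> \<gamma> \<nu> t k a (fst i) (snd i))"
    by (intro sums_sum sums_mult sm)
  moreover have "(\<lambda>n. \<Sum>i\<in>F \<times> UNIV. seq_of u (fst i) $ snd i *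
      ((- \<i> * of_real t) ^ n / fact n * (jacobi \<mu> \<gamma> \<nu> ^^ n) (unit_seq (fst i) (snd i)) k $ a))
    = (\<lambda>n. (- \<i> * of_real t) ^ n / fact n * (jacobi \<mu> \<gamma> \<nu> ^^ n) (seq_of u) k $ a)"
    by (simp only: pow sum_distrib_left mult.left_commute)
  ultimately show ?thesis
    using sums_unique2[OF exp_op_M_inf_component[OF per, of t u k a]] by (simp add: case_prod_beta)
qed

text \<open>The sources lie in [-R, R], and |k - j| >= |k| - R costs only the constant factor
  e^{\<eta> R}. The condition |k| > R keeps k away from all sources, as the kernel bound
  requires.\<close>

lemma exp_op_M_inf_decay:
  fixes C \<eta> v :: real
  assumes per: "periodic \<mu>" "periodic \<gamma>" "periodic \<nu>" and "C > 0" "\<eta> > 0"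
    and kernel: "\<And>t k a j b. j \<noteq> k \<Longrightarrow>
      cmod (propagator \<mu> \<gamma> \<nu> t k a j b) \<le> C * exp (- \<eta> * (of_int \<bar>k - j\<bar> - v * \<bar>t\<bar>))"
    and supp: "\<And>l. \<bar>l\<bar> > R \<Longrightarrow> seq_of u l = 0"
  obtains D where "D \<ge> 0" "\<And>t k. \<bar>k\<bar> > R \<Longrightarrow>
    norm (seq_of (exp_op (- \<i> * of_real t) (M_inf \<mu> \<gamma> \<nu>) u) k) \<le> D * exp (- \<eta> * (of_int \<bar>k\<bar> - v * \<bar>t\<bar>))"
proof -
  define F where "F = {- R..R}"
  have F: "finite F" "\<And>l. l \<notin> F \<Longrightarrow> seq_of u l = 0" using supp by (auto simp: F_def)
  define D where "D = (\<Sum>(j, b)\<in>F \<times> UNIV. cmod (seq_of u j $ b) * (C * exp (\<eta> * R)))"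
  have D0: "D \<ge> 0" using \<open>C > 0\<close> by (auto simp: D_def intro!: sum_nonneg)
  have comp: "cmod (seq_of (exp_op (- \<i> * of_real t) (M_inf \<mu> \<gamma> \<nu>) u) k $ a)
      \<le> D * exp (- \<eta> * (of_int \<bar>k\<bar> - v * \<bar>t\<bar>))" if k: "\<bar>k\<bar> > R" for t k a
  proof -
    have "cmod (seq_of u j $ b * propagator \<mu> \<gamma> \<nu> t k a j b)
      \<le> cmod (seq_of u j $ b) * (C * exp (\<eta> * R)) * exp (- \<eta> * (of_int \<bar>k\<bar> - v * \<bar>t\<bar>))" if "j \<in> F" for j b
    proof -
      have "j \<noteq> k" and d: "\<bar>k\<bar> - R \<le> \<bar>k - j\<bar>" using that k by (auto simp: F_def)
      have "real_of_int \<bar>k\<bar> - real_of_int R \<le> of_int \<bar>k - j\<bar>" using d by linarith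
      then have "\<eta> * (of_int \<bar>k\<bar> - R - v * \<bar>t\<bar>) \<le> \<eta> * (of_int \<bar>k - j\<bar> - v * \<bar>t\<bar>)"
        using \<open>\<eta> > 0\<close> by (intro mult_left_mono) auto
      then have "exp (- \<eta> * (of_int \<bar>k - j\<bar> - v * \<bar>t\<bar>)) \<le> exp (\<eta> * R + - \<eta> * (of_int \<bar>k\<bar> - v * \<bar>t\<bar>))"
        by (simp add: algebra_simps)
      then have "cmod (propagator \<mu> \<gamma> \<nu> t k a j b) \<le> C * (exp (\<eta> * R) * exp (- \<eta> * (of_int \<bar>k\<bar> - v * \<bar>t\<bar>)))"
        using \<open>C > 0\<close> unfolding exp_add[symmetric]
        by (intro order_trans[OF kernel[OF \<open>j \<noteq> k\<close>]] mult_left_mono) auto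
      from mult_left_mono[OF this norm_ge_zero[of "seq_of u j $ b"]] show ?thesis
        by (simp add: norm_mult mult.assoc)
    qed
    then have "cmod (\<Sum>(j, b)\<in>F \<times> UNIV. seq_of u j $ b * propagator \<mu> \<gamma> \<nu> t k a j b)
      \<le> (\<Sum>(j, b)\<in>F \<times> UNIV. cmod (seq_of u j $ b) * (C * exp (\<eta> * R)) * exp (- \<eta> * (of_int \<bar>k\<bar> - v * \<bar>t\<bar>)))"
      by (intro sum_norm_le) auto
    also have "\<dots> = D * exp (- \<eta> * (of_int \<bar>k\<bar> - v * \<bar>t\<bar>))"
      by (simp add: D_def sum_distrib_right case_prod_beta)
    also have "(\<Sum>(j, b)\<in>F \<times> UNIV. seq_of u j $ b * propagator \<mu> \<gamma> \<nu> t k a j b)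
      = seq_of (exp_op (- \<i> * of_real t) (M_inf \<mu> \<gamma> \<nu>) u) k $ a"
      by (rule exp_op_M_inf_propagator[OF per F, symmetric])
    finally show ?thesis .
  qed
  show thesis
  \<comment> \<open>The factor 2 counts the two components at each site.\<close>
  proof (rule that[of "2 * D"])
    fix t :: real and k :: int assume "\<bar>k\<bar> > R"
    let ?x = "seq_of (exp_op (- \<i> * of_real t) (M_inf \<mu> \<gamma> \<nu>) u) k"
    have "norm ?x \<le> (\<Sum>a\<in>UNIV. cmod (?x $ a))"
      unfolding norm_vec_def by (rule L2_set_le_sum) simp
    also have "\<dots> \<le> 2 * D * exp (- \<eta> * (of_int \<bar>k\<bar> - v * \<bar>t\<bar>))"
      using comp[OF \<open>\<bar>k\<bar> > R\<close>, of t 1] comp[OF \<open>\<bar>k\<bar> > R\<close>, of t 2] by (simp add: sum_2)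
    finally show "norm ?x \<le> 2 * D * exp (- \<eta> * (of_int \<bar>k\<bar> - v * \<bar>t\<bar>))" .
  qed (use D0 in simp)
qed

section \<open>Exponentially weighted sums over the integers\<close>

lemma summable_on_int_exp:
  fixes a :: real
  assumes "a > 0"
  shows "(\<lambda>k::int. exp (- a * \<bar>of_int k\<bar>)) summable_on UNIV"
proof -
  have "summable (\<lambda>n. norm (exp (- a) ^ n))"
    unfolding norm_power by (rule summable_geometric) (use assms in simp)
  then have nat: "(\<lambda>n. exp (- a) ^ n) summable_on UNIV"
    by (rule norm_summable_imp_summable_on)
  have pow: "exp (- a) ^ n = exp (- a * real n)" for n
    by (simp add: exp_of_nat_mult[symmetric] mult.commute)
  have "(\<lambda>k::int. exp (- a * \<bar>of_int k\<bar>)) summable_on (range int)"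
    using nat by (subst summable_on_reindex) (auto simp: o_def pow)
  \<comment> \<open>The negative half starts at -1, so that 0 is not counted twice.\<close>
  moreover have "(\<lambda>k::int. exp (- a * \<bar>of_int k\<bar>)) summable_on (range (\<lambda>n. - int (Suc n)))"
  proof (subst summable_on_reindex)
    have "(\<lambda>n. exp (- a) * exp (- a) ^ n) summable_on UNIV"
      by (intro summable_on_cmult_right nat)
    also have "(\<lambda>n. exp (- a) * exp (- a) ^ n) = (\<lambda>k::int. exp (- a * \<bar>of_int k\<bar>)) \<circ> (\<lambda>n. - int (Suc n))"
      by (auto simp: fun_eq_iff pow exp_add[symmetric] algebra_simps)
    finally show "(\<lambda>k::int. exp (- a * \<bar>of_int k\<bar>)) \<circ> (\<lambda>n. - int (Suc n)) summable_on UNIV" .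
  qed (auto simp: inj_on_def)
  moreover have "range int \<inter> range (\<lambda>n. - int (Suc n)) = {}" by auto
  moreover have "k \<in> range int \<union> range (\<lambda>n. - int (Suc n))" for k
  proof (cases "k \<ge> 0")
    case True
    then have "k = int (nat k)" by simp
    then show ?thesis by blast
  next
    case False
    then have "k = - int (Suc (nat (- k - 1)))" by simp
    then show ?thesis by blast
  qed
  then have "range int \<union> range (\<lambda>n. - int (Suc n)) = UNIV" by auto
  ultimately show ?thesis using summable_on_Un_disjoint by metis
qed

lemma summable_on_int_square_exp:
  fixes a :: real
  assumes "a > 0"
  shows "(\<lambda>k::int. (of_int k)\<^sup>2 * exp (- a * \<bar>of_int k\<bar>) :: real) summable_on UNIV"
proof (rule summable_on_comparison_test)
  show "(\<lambda>k::int. (8 / a\<^sup>2) * exp (- (a / 2) * \<bar>of_int k\<bar>)) summable_on UNIV"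
    using assms by (intro summable_on_cmult_right summable_on_int_exp) simp
  fix k :: int
  \<comment> \<open>Half of the exponent is spent on the square: y^2 / 2 <= e^y, and k^2 = (2y /
    a)^2 explains the constant 8 / a^2.\<close>
  define y where "y = a / 2 * \<bar>real_of_int k\<bar>"
  have "y\<^sup>2 / 2 \<le> exp y"
  proof -
    have "y \<ge> 0" using assms by (simp add: y_def)
    then show ?thesis using exp_lower_Taylor_quadratic[of y] by linarith
  qed
  moreover have "(of_int k)\<^sup>2 = 8 / a\<^sup>2 * (y\<^sup>2 / 2)"
    using assms by (simp add: y_def power_mult_distrib power_divide)
  ultimately have "(of_int k)\<^sup>2 * exp (- (2 * y)) \<le> 8 / a\<^sup>2 * exp y * exp (- (2 * y))"
    using assms by (intro mult_right_mono) (auto intro: divide_right_mono mult_left_mono)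
  also have "\<dots> = 8 / a\<^sup>2 * exp (- y)"
    by (simp add: mult.assoc exp_add[symmetric])
  finally show "(of_int k)\<^sup>2 * exp (- a * \<bar>of_int k\<bar>) \<le> (8 / a\<^sup>2) * exp (- (a / 2) * \<bar>of_int k\<bar>)"
    by (simp add: y_def)
qed simp

text \<open>The summable majorant gives more than the estimate: it puts \<open>u\<close> into the
  domain of X, where the value of \<open>Abs_l2\<close> in \<open>X_op\<close> is
  meaningful.\<close>

lemma norm_X_op_le:
  assumes "\<And>k. (of_int k * norm (seq_of u k))\<^sup>2 \<le> a\<^sup>2 * (norm (seq_of u k))\<^sup>2 + h k"
    and "h summable_on UNIV"
  shows "(norm (X_op u))\<^sup>2 \<le> a\<^sup>2 * (norm u)\<^sup>2 + infsum h UNIV"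
proof -
  have n: "(norm (of_int k *s seq_of u k))\<^sup>2 = (of_int k * norm (seq_of u k))\<^sup>2" for k
    by (simp add: norm_vector_scalar_mult power_mult_distrib)
  have dom: "(\<lambda>k. a\<^sup>2 * (norm (seq_of u k))\<^sup>2 + h k) summable_on UNIV"
    by (intro summable_on_add summable_on_cmult_right l2_summable_sq assms(2))
  have sm: "(\<lambda>k. (norm (of_int k *s seq_of u k))\<^sup>2) summable_on UNIV"
    by (rule summable_on_comparison_test[OF dom]) (use assms(1) n in auto)
  have "(norm (X_op u))\<^sup>2 = (\<Sum>\<^sub>\<infinity>k. (norm (of_int k *s seq_of u k))\<^sup>2)"
    unfolding X_op_def norm_l2_eq using sm by (simp add: Abs_l2_inverse infsum_nonneg)
  also have "\<dots> \<le> (\<Sum>\<^sub>\<infinity>k. a\<^sup>2 * (norm (seq_of u k))\<^sup>2 + h k)"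
    by (rule infsum_mono[OF sm dom]) (use assms(1) n in auto)
  also have "\<dots> = a\<^sup>2 * (norm u)\<^sup>2 + infsum h UNIV"
    using l2_infsum_shift[of u 0]
    by (simp add: infsum_add summable_on_cmult_right l2_summable_sq assms(2) infsum_cmult_right')
  finally show ?thesis .
qed

text \<open>Sites with |k| <= (v + \<epsilon>) t contribute at most the main term. The sites beyond
  contribute a remainder bounded independently of t, which disappears after division by t^2.\<close>

lemma velocity_bound_eps:
  fixes \<eta> v \<epsilon> D :: real and R :: int
  assumes per: "periodic \<mu>" "periodic \<gamma>" "periodic \<nu>"
    and Q: "is_asymptotic_velocity (M_inf \<mu> \<gamma> \<nu>) Q"
    and pos: "\<eta> > 0" "v \<ge> 0" "\<epsilon> > 0" "D \<ge> 0" "R \<ge> 0"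
    and decay: "\<And>t k. \<bar>k\<bar> > R \<Longrightarrow>
      norm (seq_of (exp_op (- \<i> * of_real t) (M_inf \<mu> \<gamma> \<nu>) u) k) \<le> D * exp (- \<eta> * (of_int \<bar>k\<bar> - v * \<bar>t\<bar>))"
    and supp: "\<And>l. \<bar>l\<bar> > R \<Longrightarrow> seq_of u l = 0"
  shows "norm (Q u) \<le> (v + \<epsilon>) * norm u"
proof -
  let ?M = "M_inf \<mu> \<gamma> \<nu>"
  define \<phi> where "\<phi> t = exp_op (- \<i> * of_real t) ?M u" for t
  \<comment> \<open>Chosen so that v t = (1 - \<delta>) (v + \<epsilon>) t. Hence |k| - v t >=
    \<delta> |k| beyond the cone, and the majorant \<open>h\<close> is free of t.\<close>
  define \<delta> where "\<delta> = \<epsilon> / (v + \<epsilon>)"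
  have \<delta>: "\<delta> > 0" using pos by (simp add: \<delta>_def)
  define h where "h k = D\<^sup>2 * ((of_int k)\<^sup>2 * exp (- (2 * \<eta> * \<delta>) * \<bar>of_int k\<bar>))" for k :: int
  have h: "h summable_on UNIV"
    unfolding h_def using pos \<delta> by (intro summable_on_cmult_right summable_on_int_square_exp) simp
  define B where "B = infsum h UNIV"
  \<comment> \<open>The second condition on t places all sites beyond the cone outside [-R, R],
    where \<open>decay\<close> is available.\<close>
  have bound: "(norm ((1 / t) *\<^sub>R exp_op (\<i> * of_real t) ?M (X_op (\<phi> t))))\<^sup>2 \<le> (v + \<epsilon>)\<^sup>2 * (norm u)\<^sup>2 + B / t\<^sup>2"
    if t: "t > 0" "(v + \<epsilon>) * t \<ge> R" for t
  proof -
    define a where "a = (v + \<epsilon>) * t"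
    have a: "a > 0" "v * t = (1 - \<delta>) * a"
      using pos t mult_pos_pos[of "v + \<epsilon>" t] by (auto simp: a_def \<delta>_def field_simps)
    have d1: "1 - \<delta> \<ge> 0" using pos by (simp add: \<delta>_def)
    have "(of_int k * norm (seq_of (\<phi> t) k))\<^sup>2 \<le> a\<^sup>2 * (norm (seq_of (\<phi> t) k))\<^sup>2 + h k" for k
    proof (cases "\<bar>real_of_int k\<bar> \<le> a")
      case True
      then have "(of_int k)\<^sup>2 \<le> a\<^sup>2" by (simp add: abs_le_square_iff[symmetric])
      then have "(of_int k)\<^sup>2 * (norm (seq_of (\<phi> t) k))\<^sup>2 \<le> a\<^sup>2 * (norm (seq_of (\<phi> t) k))\<^sup>2"
        by (rule mult_right_mono) simp
      moreover have "h k \<ge> 0" by (simp add: h_def)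
      ultimately show ?thesis by (simp add: power_mult_distrib)
    next
      case False
      then have kR: "\<bar>k\<bar> > R" using t(2) unfolding a_def by linarith
      have "(1 - \<delta>) * a \<le> (1 - \<delta>) * \<bar>of_int k\<bar>" using False d1 by (intro mult_left_mono) auto
      then have "\<eta> * (\<delta> * \<bar>of_int k\<bar>) \<le> \<eta> * (\<bar>of_int k\<bar> - v * \<bar>t\<bar>)"
        using pos t a by (intro mult_left_mono) (auto simp: algebra_simps)
      then have "norm (seq_of (\<phi> t) k) \<le> D * exp (- (\<eta> * (\<delta> * \<bar>of_int k\<bar>)))"
        using pos decay[OF kR, of t] unfolding \<phi>_def
        by (elim order_trans) (intro mult_left_mono, auto)
      then have "(norm (seq_of (\<phi> t) k))\<^sup>2 \<le> (D * exp (- (\<eta> * (\<delta> * \<bar>of_int k\<bar>))))\<^sup>2"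
        by (intro power_mono) auto
      also have "\<dots> = D\<^sup>2 * exp (- (2 * \<eta> * \<delta>) * \<bar>of_int k\<bar>)"
        by (simp add: power_mult_distrib exp_double[symmetric] mult_ac)
      finally have "(of_int k)\<^sup>2 * (norm (seq_of (\<phi> t) k))\<^sup>2
          \<le> (of_int k)\<^sup>2 * (D\<^sup>2 * exp (- (2 * \<eta> * \<delta>) * \<bar>of_int k\<bar>))"
        by (rule mult_left_mono) simp
      also have "\<dots> = h k" by (simp add: h_def)
      also have "\<dots> \<le> a\<^sup>2 * (norm (seq_of (\<phi> t) k))\<^sup>2 + h k" by simp
      finally show ?thesis by (simp only: power_mult_distrib)
    qed
    then have "(norm (X_op (\<phi> t)))\<^sup>2 \<le> a\<^sup>2 * (norm (\<phi> t))\<^sup>2 + B"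
      unfolding B_def by (rule norm_X_op_le[OF _ h])
    \<comment> \<open>Isometry replaces the norm of the evolved vector by that of \<open>u\<close>;
      afterwards it removes the outer exponential.\<close>
    then have "(norm (X_op (\<phi> t)))\<^sup>2 / t\<^sup>2 \<le> (a\<^sup>2 * (norm u)\<^sup>2 + B) / t\<^sup>2"
      unfolding \<phi>_def norm_exp_op_M_inf_neg[OF per] by (rule divide_right_mono) simp
    then show ?thesis
      using t by (simp add: norm_exp_op_M_inf[OF per] power_divide add_divide_distrib a_def power_mult_distrib)
  qed
  have X: "u \<in> X_domain"
  proof -
    have "(\<lambda>j. (norm (of_int j *s seq_of u j))\<^sup>2) summable_on {- R..R}" by simp
    then show ?thesis
      unfolding X_domain_def mem_Collect_eq
      by (rule summable_on_cong_neutral[THEN iffD1, rotated -1]) (use supp in \<open>auto simp: abs_if split: if_splits\<close>)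
  qed
  have "(norm (Q u))\<^sup>2 \<le> (v + \<epsilon>)\<^sup>2 * (norm u)\<^sup>2"
  proof (rule tendsto_le)
    show "((\<lambda>t. (norm ((1 / t) *\<^sub>R exp_op (\<i> * of_real t) ?M (X_op (\<phi> t))))\<^sup>2) \<longlongrightarrow> (norm (Q u))\<^sup>2) at_top"
      using Q X unfolding is_asymptotic_velocity_def \<phi>_def by (intro tendsto_intros) blast
    have "((\<lambda>t. (v + \<epsilon>)\<^sup>2 * (norm u)\<^sup>2 + B / t\<^sup>2) \<longlongrightarrow> (v + \<epsilon>)\<^sup>2 * (norm u)\<^sup>2 + 0) at_top"
      by (intro tendsto_add tendsto_const tendsto_divide_0[OF tendsto_const]
          filterlim_at_top_imp_at_infinity filterlim_pow_at_top filterlim_ident) simp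
    then show "((\<lambda>t. (v + \<epsilon>)\<^sup>2 * (norm u)\<^sup>2 + B / t\<^sup>2) \<longlongrightarrow> (v + \<epsilon>)\<^sup>2 * (norm u)\<^sup>2) at_top"
      by simp
    show "\<forall>\<^sub>F t in at_top. (norm ((1 / t) *\<^sub>R exp_op (\<i> * of_real t) ?M (X_op (\<phi> t))))\<^sup>2
        \<le> (v + \<epsilon>)\<^sup>2 * (norm u)\<^sup>2 + B / t\<^sup>2"
      using eventually_gt_at_top[of 0] eventually_ge_at_top[of "R / (v + \<epsilon>)"]
    proof eventually_elim
      case (elim t)
      then show ?case using pos by (intro bound) (auto simp: field_simps)
    qed
  qed simp
  then show ?thesis
    using pos by (simp add: power_mult_distrib[symmetric] power2_le_iff_abs_le)
qed

section \<open>Density of finitely supported vectors and conclusion\<close>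

text \<open>The truncations of \<open>u\<close> converge along the net of finite sets: by Pythagoras
  the squared error is the norm squared minus a partial sum. Both sides of the inequality are
  continuous.\<close>

lemma norm_le_dense:
  assumes "bounded_linear Q" and fin: "\<And>u F. finite F \<Longrightarrow> (\<And>l. l \<notin> F \<Longrightarrow> seq_of u l = 0) \<Longrightarrow> norm (Q u) \<le> v * norm u"
  shows "norm (Q u) \<le> v * norm (u :: l2)"
proof -
  define w where "w F l = (if l \<in> F then seq_of u l else 0)" for F l
  let ?top = "finite_subsets_at_top (UNIV :: int set)"
  have lim: "((\<lambda>F. Abs_l2 (w F)) \<longlongrightarrow> u) ?top"
  proof -
    have "norm (Abs_l2 (w F) - u) = sqrt ((norm u)\<^sup>2 - (\<Sum>l\<in>F. (norm (seq_of u l))\<^sup>2))" if "finite F" for F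
    proof -
      have s: "seq_of (Abs_l2 (w F)) = w F" by (rule l2_finite_support[OF that]) (simp add: w_def)
      have sF: "(\<lambda>l. if l \<in> F then (norm (seq_of u l))\<^sup>2 else 0) summable_on UNIV"
        and iF: "(\<Sum>\<^sub>\<infinity>l. if l \<in> F then (norm (seq_of u l))\<^sup>2 else 0) = (\<Sum>l\<in>F. (norm (seq_of u l))\<^sup>2)"
        using that has_sum_finite_neutralI[of F UNIV "\<lambda>l. if l \<in> F then (norm (seq_of u l))\<^sup>2 else 0"]
        by (auto simp: has_sum_imp_summable infsumI)
      have "(norm (seq_of u l))\<^sup>2 = (norm (seq_of (Abs_l2 (w F) - u) l))\<^sup>2 + (if l \<in> F then (norm (seq_of u l))\<^sup>2 else 0)" for l
        by (simp add: minus_l2.rep_eq s w_def)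
      then have "(\<Sum>\<^sub>\<infinity>l. (norm (seq_of u l))\<^sup>2) = (\<Sum>\<^sub>\<infinity>l. (norm (seq_of (Abs_l2 (w F) - u) l))\<^sup>2) + (\<Sum>l\<in>F. (norm (seq_of u l))\<^sup>2)"
        using infsum_add[OF l2_summable_sq[of "Abs_l2 (w F) - u"] sF] iF by simp
      then show ?thesis
        using l2_infsum_shift[of u 0] by (simp add: norm_l2_eq[of "Abs_l2 (w F) - u"])
    qed
    then have "\<forall>\<^sub>F F in ?top. norm (Abs_l2 (w F) - u) = sqrt ((norm u)\<^sup>2 - (\<Sum>l\<in>F. (norm (seq_of u l))\<^sup>2))"
      by (intro eventually_finite_subsets_at_top_weakI)
    moreover have "((\<lambda>F. sqrt ((norm u)\<^sup>2 - (\<Sum>l\<in>F. (norm (seq_of u l))\<^sup>2))) \<longlongrightarrow> sqrt ((norm u)\<^sup>2 - (norm u)\<^sup>2)) ?top"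
      using infsum_tendsto[OF l2_summable_sq[of u]] l2_infsum_shift[of u 0]
      by (intro tendsto_intros) simp
    ultimately have "((\<lambda>F. norm (Abs_l2 (w F) - u)) \<longlongrightarrow> 0) ?top"
      by (simp add: tendsto_cong)
    then show ?thesis
      using tendsto_norm_zero_iff LIM_zero_iff by blast
  qed
  show ?thesis
  proof (rule tendsto_le)
    show "((\<lambda>F. v * norm (Abs_l2 (w F))) \<longlongrightarrow> v * norm u) ?top" by (intro tendsto_intros lim)
    show "((\<lambda>F. norm (Q (Abs_l2 (w F)))) \<longlongrightarrow> norm (Q u)) ?top"
      by (intro tendsto_norm bounded_linear.tendsto[OF assms(1)] lim)
    show "\<forall>\<^sub>F F in ?top. norm (Q (Abs_l2 (w F))) \<le> v * norm (Abs_l2 (w F))"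
    proof (rule eventually_finite_subsets_at_top_weakI)
      fix F :: "int set" assume "finite F"
      moreover from this have "seq_of (Abs_l2 (w F)) = w F" by (rule l2_finite_support) (simp add: w_def)
      ultimately show "norm (Q (Abs_l2 (w F))) \<le> v * norm (Abs_l2 (w F))"
        by (intro fin[of F]) (auto simp: w_def)
    qed
  qed simp
qed

theorem theorem3p7:
  fixes \<mu> \<gamma> \<nu> :: "int \<Rightarrow> real" and Q :: "l2 \<Rightarrow> l2"
    and n0 :: nat and C \<eta> v :: real
  assumes "\<And>j. \<mu> j \<noteq> 0" and "\<And>j. \<gamma> j \<noteq> 1 \<and> \<gamma> j \<noteq> - 1"
    and "periodic \<mu>" and "periodic \<gamma>" and "periodic \<nu>"
    and "is_asymptotic_velocity (M_inf \<mu> \<gamma> \<nu>) Q"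
    and "C > 0" and "\<eta> > 0" and "v \<ge> 0"
    and "\<And>m n A B t. m \<le> n \<Longrightarrow> card {m..n} \<ge> n0 \<Longrightarrow> (A, B) \<in> D_pairs {m..n} \<Longrightarrow>
      op_norm {m..n} (commutator {m..n} (evolve \<mu> \<gamma> \<nu> m n t A) B)
        \<le> C * op_norm {m..n} A * op_norm {m..n} B *
          exp (- \<eta> * (of_int (site_dist (supp {m..n} A) (supp {m..n} B)) - v * \<bar>t\<bar>))"
  shows "v \<ge> onorm Q"
proof -
  note per = \<open>periodic \<mu>\<close> \<open>periodic \<gamma>\<close> \<open>periodic \<nu>\<close>
  have kernel: "cmod (propagator \<mu> \<gamma> \<nu> t k a j b) \<le> C * exp (- \<eta> * (of_int \<bar>k - j\<bar> - v * \<bar>t\<bar>))"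
    if "j \<noteq> k" for t k a j b
    by (rule propagator_bound[OF per \<open>C > 0\<close> assms(10) that])
  have fin: "norm (Q u) \<le> v * norm u" if F: "finite F" "\<And>l. l \<notin> F \<Longrightarrow> seq_of u l = 0" for u F
  proof -
    \<comment> \<open>Inserting 0 keeps \<open>Max\<close> meaningful for empty \<open>F\<close> and
      makes R nonnegative.\<close>
    define R where "R = Max (insert 0 (abs ` F))"
    have supp: "seq_of u l = 0" if "\<bar>l\<bar> > R" for l
      using F that by (auto simp: R_def)
    have "R \<ge> 0" using F(1) by (simp add: R_def)
    obtain D where D: "D \<ge> 0" "\<And>t k. \<bar>k\<bar> > R \<Longrightarrow>
      norm (seq_of (exp_op (- \<i> * of_real t) (M_inf \<mu> \<gamma> \<nu>) u) k) \<le> D * exp (- \<eta> * (of_int \<bar>k\<bar> - v * \<bar>t\<bar>))"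
      using exp_op_M_inf_decay[OF per \<open>C > 0\<close> \<open>\<eta> > 0\<close> kernel supp] by blast
    have "norm (Q u) \<le> (v + \<epsilon>) * norm u" if "\<epsilon> > 0" for \<epsilon>
      by (rule velocity_bound_eps[OF per assms(6) \<open>\<eta> > 0\<close> \<open>v \<ge> 0\<close> that D(1) \<open>R \<ge> 0\<close> D(2) supp])
    \<comment> \<open>The bound holds for each positive \<epsilon> with \<open>u\<close> fixed, so
      it survives \<epsilon> tending to 0 from the right.\<close>
    then have "\<forall>\<^sub>F \<epsilon> in at_right 0. norm (Q u) \<le> (v + \<epsilon>) * norm u"
      by (auto simp: eventually_at_right_less intro: eventually_mono[OF eventually_at_right_less])
    moreover have "((\<lambda>\<epsilon>. (v + \<epsilon>) * norm u) \<longlongrightarrow> (v + 0) * norm u) (at_right 0)"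
      by (intro tendsto_intros)
    ultimately show ?thesis
      using tendsto_lowerbound[of "\<lambda>\<epsilon>. (v + \<epsilon>) * norm u" "v * norm u" "at_right 0" "norm (Q u)"] by simp
  qed
  have "bounded_linear Q"
    using assms(6) by (simp add: is_asymptotic_velocity_def bounded_self_adjoint_def)
  show ?thesis
  proof (rule onorm_bound[OF \<open>v \<ge> 0\<close>])
    show "norm (Q u) \<le> v * norm u" for u
      by (rule norm_le_dense[OF \<open>bounded_linear Q\<close>]) (rule fin)
  qed
qed

end
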